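(* Let $C\subset\mathbb{P}^2$ be a rational curve of degree $d=2n+\delta$, $\delta\in\{0,1\}$, parameterized by $\varphi_i=\varphi_{i,0}s^{d}+\varphi_{i,1}s^{d-1}t+\cdots+\varphi_{i,d}t^{d}$ for $i=0,1,2$. Define the $(3n+\delta)\times 3n$ matrix $$M(\varphi)=M=(m_{u,v})_{0\le u\le 3n-1+\delta,\ 0\le v\le 3n-1}$$ as follows: writing $v=3w+i$ as a multiple of $3$ with remainder $i$ (so $0\le i\le 2$), let $m_{u,v}=\varphi_{i,d+w-u}$ if $0\le d+w-u\le d$, and $m_{u,v}=0$ otherwise. Then the splitting type of $C$ is $(n-p,\,n+p+\delta)$ if and only if $\operatorname{rk} M=3n-p$.
   Context: Work over an algebraically closed field $K$. A rational curve $C\subset\mathbb{P}^2$ of degree $d$ is parameterized by three homogeneous polynomials $\varphi_0,\varphi_1,\varphi_2\in K[s,t]$ of degree $d$ with no common factor, such that the morphism $\varphi=(\varphi_0,\varphi_1,\varphi_2):\mathbb{P}^1\to\mathbb{P}^2$ is generically injective and generically smooth over its image (i.e. birational onto its image) and $C=\varphi(\mathbb{P}^1)$. Splitting type: $\varphi^*\Omega_{\mathbb{P}^2}(1)\cong\mathcal{O}_{\mathbb{P}^1}(-a)\oplus\mathcal{O}_{\mathbb{P}^1}(-b)$ with $0\le a\le b$ and $a+b=d$; the pair $(a,b)$ is the splitting type of $C$. *)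

theory Defs
  imports
    "HOL-Computational_Algebra.Computational_Algebra"
    "Jordan_Normal_Form.DL_Rank"
begin

text \<open>
  A point of projective \<open>m\<close>-space is the set of all its representatives, that is, a line
  through the origin of \<open>K\<^sup>m\<^sup>+\<^sup>1\<close> with the origin removed.
\<close>

definition proj_point :: "'a::field vec \<Rightarrow> 'a vec set" where
  "proj_point v = {c \<cdot>\<^sub>v v | c. c \<noteq> 0}"

definition proj_space :: "nat \<Rightarrow> 'a::field vec set set" where
  "proj_space m = {proj_point v | v. v \<in> carrier_vec (Suc m) \<and> v \<noteq> 0\<^sub>v (Suc m)}"

abbreviation P1 :: "'a::field vec set set" where
  "P1 \<equiv> proj_space 1"

text \<open>
  The ring \<open>K[s,t]\<close> is \<^typ>\<open>'a poly poly\<close> with inner variable \<open>s\<close> and outer variable \<open>t\<close>.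
  Note that \<open>0\<close> is homogeneous of every degree.
\<close>

definition homogeneous :: "nat \<Rightarrow> 'a::zero poly poly \<Rightarrow> bool" where
  "homogeneous e f \<longleftrightarrow> (\<forall>i j. coeff (coeff f j) i \<noteq> 0 \<longrightarrow> i + j = e)"

definition eval2 :: "'a::comm_semiring_1 poly poly \<Rightarrow> 'a vec \<Rightarrow> 'a" where
  "eval2 f v = poly (poly f [:v $ 1:]) (v $ 0)"

definition principal_open :: "'a::field poly poly \<Rightarrow> 'a vec set set" where
  "principal_open f = {P \<in> P1. \<forall>v\<in>P. eval2 f v \<noteq> 0}"

definition zariski_open :: "'a::field vec set set \<Rightarrow> bool" where
  "zariski_open U \<longleftrightarrow>
     (\<exists>S. (\<forall>f\<in>S. \<exists>e. homogeneous e f) \<and> U = (\<Union>f\<in>S. principal_open f))"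

text \<open>A triple of forms is a function on \<^typ>\<open>nat\<close> of which only the values at 0, 1, 2 matter.\<close>

definition form_vec :: "(nat \<Rightarrow> 'a::comm_semiring_1 poly poly) \<Rightarrow> 'a vec \<Rightarrow> 'a vec" where
  "form_vec \<phi> v = vec 3 (\<lambda>i. eval2 (\<phi> i) v)"

text \<open>For forms of one degree without common zero, the union below is a single point.\<close>

definition curve_map :: "(nat \<Rightarrow> 'a::field poly poly) \<Rightarrow> 'a vec set \<Rightarrow> 'a vec set" where
  "curve_map \<phi> P = (\<Union>v\<in>P. proj_point (form_vec \<phi> v))"

definition generically_injective :: "(nat \<Rightarrow> 'a::field poly poly) \<Rightarrow> bool" where
  "generically_injective \<phi> \<longleftrightarrow>
     (\<exists>U. zariski_open U \<and> U \<noteq> {} \<and> inj_on (curve_map \<phi>) U)"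

text \<open>
  The ring \<open>K[x,y,z]\<close> is \<^typ>\<open>'a poly poly poly\<close> with innermost variable \<open>x\<close> and outermost
  variable \<open>z\<close>; \<open>eval3_grad G q w\<close> is the derivative of \<open>G\<close> at \<open>q\<close> in direction \<open>w\<close>.
\<close>

definition eval3 :: "'a::comm_semiring_1 poly poly poly \<Rightarrow> 'a vec \<Rightarrow> 'a" where
  "eval3 G q = poly (poly (poly G [:[:q $ 2:]:]) [:q $ 1:]) (q $ 0)"

definition eval3_grad :: "'a::field poly poly poly \<Rightarrow> 'a vec \<Rightarrow> 'a vec \<Rightarrow> 'a" where
  "eval3_grad G q w =
     eval3 (map_poly (map_poly pderiv) G) q * w $ 0 +
     eval3 (map_poly pderiv G) q * w $ 1 +
     eval3 (pderiv G) q * w $ 2"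

text \<open>
  The Zariski tangent space at \<open>q\<close> of the affine cone over \<open>C\<close>. The polynomials vanishing on
  \<open>\<Union>C\<close> are exactly those vanishing on the cone. The tangent space of \<open>C\<close> at the point
  represented by \<open>q\<close> is the quotient of \<open>cone_tangent C q\<close> by the line \<open>K q\<close>.
\<close>

definition cone_tangent :: "'a::field vec set set \<Rightarrow> 'a vec \<Rightarrow> 'a vec set" where
  "cone_tangent C q =
     {w \<in> carrier_vec 3. \<forall>G. (\<forall>r\<in>\<Union>C. eval3 G r = 0) \<longrightarrow> eval3_grad G q w = 0}"

text \<open>
  Smoothness over the image \<open>C\<close> at a point of the projective line: the differential is onto the
  tangent space of \<open>C\<close>. The image of the differential, as a subspace of the tangent space of the
  cone, is spanned by the two partial derivatives and by the point itself (which is divided out).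
  Since that span has dimension at most 2, by Euler's formula, the condition includes that \<open>C\<close>
  is nonsingular at the image point.
\<close>

definition smooth_over_image_at ::
    "'a::field vec set set \<Rightarrow> (nat \<Rightarrow> 'a poly poly) \<Rightarrow> 'a vec set \<Rightarrow> bool" where
  "smooth_over_image_at C \<phi> P \<longleftrightarrow>
     (\<forall>v\<in>P. cone_tangent C (form_vec \<phi> v) =
        {x \<cdot>\<^sub>v form_vec (\<lambda>i. map_poly pderiv (\<phi> i)) v + y \<cdot>\<^sub>v form_vec (\<lambda>i. pderiv (\<phi> i)) v
           + z \<cdot>\<^sub>v form_vec \<phi> v | x y z. True})"

definition generically_smooth_over_image ::
    "'a::field vec set set \<Rightarrow> (nat \<Rightarrow> 'a poly poly) \<Rightarrow> bool" where
  "generically_smooth_over_image C \<phi> \<longleftrightarrow>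
     (\<exists>U. zariski_open U \<and> U \<noteq> {} \<and> (\<forall>P\<in>U. smooth_over_image_at C \<phi> P))"

definition parameterizes_rational_curve ::
    "nat \<Rightarrow> (nat \<Rightarrow> 'a::field poly poly) \<Rightarrow> 'a vec set set \<Rightarrow> bool" where
  "parameterizes_rational_curve d \<phi> C \<longleftrightarrow>
     (\<forall>i<3. homogeneous d (\<phi> i)) \<and>
     (\<forall>g. (\<forall>i<3. g dvd \<phi> i) \<longrightarrow> is_unit g) \<and>
     C = curve_map \<phi> ` P1 \<and>
     generically_injective \<phi> \<and> generically_smooth_over_image C \<phi>"

text \<open>
  Rational sections of a bundle given by charts have coordinates in the field of fractions
  \<open>K(s,t)\<close>; a sheaf is given by its regular sections over each nonempty open set, as a family of
  elements of \<open>K(s,t)\<close>. The projective line is irreducible, so a section over a nonempty open set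
  is determined by the underlying rational section, and the restriction maps are inclusions.
\<close>

type_synonym 'a rat = "'a poly poly fract"

type_synonym ('a, 'i) sheaf = "'a vec set set \<Rightarrow> ('i \<Rightarrow> 'a rat) set"

text \<open>The sections of \<open>\<O>(m)\<close> over \<open>U\<close>; in particular \<open>twist 0\<close> is the structure sheaf.\<close>

definition twist :: "int \<Rightarrow> 'a::field vec set set \<Rightarrow> 'a rat set" where
  "twist m U = {f. \<forall>P\<in>U. \<exists>g h k l. homogeneous k g \<and> homogeneous l h \<and> int k = int l + m \<and>
                      P \<in> principal_open h \<and> f = Fract g h}"

definition sum_twists :: "int \<Rightarrow> int \<Rightarrow> ('a::field, nat) sheaf" where
  "sum_twists m m' U = {\<sigma>. \<sigma> 0 \<in> twist m U \<and> \<sigma> 1 \<in> twist m' U \<and> (\<forall>i\<ge>2. \<sigma> i = 0)}"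

text \<open>Isomorphism of sheaves of modules over the structure sheaf.\<close>

definition sheaf_iso :: "('a::field, 'i) sheaf \<Rightarrow> ('a, 'j) sheaf \<Rightarrow> bool" where
  "sheaf_iso E F \<longleftrightarrow> (\<exists>\<Phi>.
     (\<forall>U. zariski_open U \<and> U \<noteq> {} \<longrightarrow>
        bij_betw (\<Phi> U) (E U) (F U) \<and>
        (\<forall>\<sigma>\<in>E U. \<forall>\<tau>\<in>E U. \<Phi> U (\<lambda>i. \<sigma> i + \<tau> i) = (\<lambda>j. \<Phi> U \<sigma> j + \<Phi> U \<tau> j)) \<and>
        (\<forall>f\<in>twist 0 U. \<forall>\<sigma>\<in>E U. \<Phi> U (\<lambda>i. f * \<sigma> i) = (\<lambda>j. f * \<Phi> U \<sigma> j))) \<and>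
     (\<forall>U V. zariski_open U \<and> zariski_open V \<and> V \<noteq> {} \<and> V \<subseteq> U \<longrightarrow>
        (\<forall>\<sigma>\<in>E U. \<Phi> V \<sigma> = \<Phi> U \<sigma>)))"

text \<open>
  On the chart \<open>x i \<noteq> 0\<close> of the projective plane, the sheaf \<open>\<Omega>\<close> has the frame
  \<open>d(x j / x i)\<close>, \<open>j \<noteq> i\<close>. The coefficient of \<open>d(x l / x k)\<close> in \<open>d(x j / x i)\<close>, for \<open>l \<noteq> k\<close>, is
  the partial derivative of \<open>(x j / x k) / (x i / x k)\<close> with respect to \<open>x l / x k\<close>.
\<close>

definition cotangent_transition ::
    "(nat \<Rightarrow> 'b::field) \<Rightarrow> nat \<Rightarrow> nat \<Rightarrow> nat \<Rightarrow> nat \<Rightarrow> 'b" where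
  "cotangent_transition x i k j l =
     (if l = j then x k / x i else 0) - (if l = i then x j * x k / (x i)^2 else 0)"

text \<open>
  The pullback along \<open>\<phi>\<close> of \<open>\<Omega>(1)\<close>. Over the preimage \<open>principal_open (\<phi> i)\<close> of the \<open>i\<close>-th chart it
  is free on the pullbacks of \<open>x i \<otimes> d(x j / x i)\<close>, \<open>j \<noteq> i\<close>, and \<open>\<sigma> (i, j)\<close> is the coordinate of a
  section with respect to this frame. Coordinates on two charts are related by the pulled back
  transition matrix of \<open>\<Omega>\<close> multiplied by that of \<open>\<O>(1)\<close>, which is \<open>x i = (x i / x k) x k\<close>. Charts
  with empty preimage (\<open>\<phi> i = 0\<close>) are left out; all unused coordinates are 0.
\<close>

definition pullback_cotangent_twist ::
    "(nat \<Rightarrow> 'a::field poly poly) \<Rightarrow> ('a, nat \<times> nat) sheaf" where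
  "pullback_cotangent_twist \<phi> U =
     (let x = (\<lambda>i. Fract (\<phi> i) 1); I = {i. i < 3 \<and> \<phi> i \<noteq> 0} in
      {\<sigma>. (\<forall>i\<in>I. \<forall>j\<in>{..<3} - {i}. \<sigma> (i, j) \<in> twist 0 (U \<inter> principal_open (\<phi> i))) \<and>
          (\<forall>i j. \<not> (i \<in> I \<and> j \<in> {..<3} - {i}) \<longrightarrow> \<sigma> (i, j) = 0) \<and>
          (\<forall>i\<in>I. \<forall>k\<in>I. \<forall>l\<in>{..<3} - {k}.
             \<sigma> (k, l) =
               (\<Sum>j\<in>{..<3} - {i}. \<sigma> (i, j) * (x i / x k * cotangent_transition x i k j l)))})"

definition has_splitting_type ::
    "nat \<Rightarrow> (nat \<Rightarrow> 'a::field poly poly) \<Rightarrow> int \<Rightarrow> int \<Rightarrow> bool" where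
  "has_splitting_type d \<phi> a b \<longleftrightarrow>
     0 \<le> a \<and> a \<le> b \<and> a + b = int d \<and>
     sheaf_iso (pullback_cotangent_twist \<phi>) (sum_twists (- a) (- b))"

definition binary_form :: "nat \<Rightarrow> (nat \<Rightarrow> 'a::comm_semiring_1) \<Rightarrow> 'a poly poly" where
  "binary_form d c = (\<Sum>j\<le>d. monom (monom (c j) (d - j)) j)"

definition coeff_matrix :: "nat \<Rightarrow> nat \<Rightarrow> (nat \<Rightarrow> nat \<Rightarrow> 'a::zero) \<Rightarrow> 'a mat" where
  "coeff_matrix n \<delta> c =
     mat (3 * n + \<delta>) (3 * n) (\<lambda>(u, v).
       let d = 2 * n + \<delta>; w = v div 3; i = v mod 3
       in if u \<le> d + w \<and> d + w - u \<le> d then c i (d + w - u) else 0)"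

end

theory Submission
  imports Defs "Jordan_Normal_Form.Matrix_Kernel"
begin

text \<open>
  Over an algebraically closed field the syzygies of \<open>\<phi>\<close> are free on two homogeneous generators
  \<open>P\<close>, \<open>Q\<close> of degrees \<open>a \<le> b\<close>, \<open>a + b = d\<close>, which can be scaled such that \<open>\<phi> = P \<times> Q\<close> (cross product).
  They are found after setting \<open>t = 1\<close>: \<open>P\<close> is a nonzero syzygy of least degree and \<open>Q\<close> a syzygy of least
  degree that is not a multiple of \<open>P\<close>. Minimality makes the leading coefficient vectors independent,
  so \<open>P \<times> Q\<close> has degree \<open>a + b\<close>; it is a multiple \<open>\<lambda> \<phi>\<close>, and a root \<open>r\<close> of \<open>\<lambda>\<close> would make a
  combination of \<open>P\<close> and \<open>Q\<close> divisible by \<open>s - r\<close>, against minimality.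

  By the Euler sequence the pullback of \<open>\<Omega>(1)\<close> is the sheaf of syzygies, and \<open>(f, g) \<mapsto> f P + g Q\<close>
  is an isomorphism from \<open>\<O>(-a) \<oplus> \<O>(-b)\<close>: by Cramer's rule the inverse takes \<open>A\<close> to the ratios
  \<open>(A \<times> Q) / \<phi>\<close> and \<open>(P \<times> A) / \<phi>\<close>. The splitting type is unique because \<open>a\<close> is the least \<open>m\<close> for
  which the \<open>m\<close>-th twist has a nonzero global section.

  Finally, the kernel of \<open>M\<close> consists of the syzygies of degree \<open>n - 1 < b\<close>, that is, of the multiples \<open>u P\<close>
  with \<open>u\<close> of degree \<open>n - 1 - a\<close>, so \<open>rk M = 3 n - (n - a)\<close>.
\<close>

section \<open>Syzygies of three univariate polynomials\<close>

text \<open>The vector product: cyclic indices put all three components, with their signs, into one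
  formula.\<close>

definition cross3 :: "(nat \<Rightarrow> 'b::comm_ring) \<Rightarrow> (nat \<Rightarrow> 'b) \<Rightarrow> nat \<Rightarrow> 'b" where
  "cross3 A B i =
     A ((i + 1) mod 3) * B ((i + 2) mod 3) - A ((i + 2) mod 3) * B ((i + 1) mod 3)"

definition dot3 :: "(nat \<Rightarrow> 'b::comm_ring) \<Rightarrow> (nat \<Rightarrow> 'b) \<Rightarrow> 'b" where
  "dot3 A B = A 0 * B 0 + A 1 * B 1 + A 2 * B 2"

lemma cross3_simps [simp]:
  "cross3 A B 0 = A 1 * B 2 - A 2 * B 1"
  "cross3 A B (Suc 0) = A 2 * B 0 - A 0 * B 2"
  "cross3 A B 2 = A 0 * B 1 - A 1 * B 0"
  by (simp_all add: cross3_def mod_Suc numeral_2_eq_2[symmetric])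

lemma all_less_3: "(\<forall>i<3. R i) \<longleftrightarrow> R 0 \<and> R (Suc 0) \<and> R (2::nat)"
  by (auto simp: eval_nat_numeral less_Suc_eq)

lemma less_3_cases:
  assumes "i < (3::nat)"
  obtains "i = 0" | "i = Suc 0" | "i = 2"
  using assms by (auto simp: eval_nat_numeral less_Suc_eq)

lemma ex_less_3: "(\<exists>i<3. R i) \<longleftrightarrow> R 0 \<or> R (Suc 0) \<or> R (2::nat)"
  by (auto simp: eval_nat_numeral less_Suc_eq)

text \<open>\<open>cross3 P Q\<close> and \<open>f\<close> are both orthogonal to \<open>P\<close>
  and \<open>Q\<close>. The triple product expansion writes every 2 by 2 minor of this pair as a
  combination of \<open>dot3 P f\<close> and \<open>dot3 Q f\<close>.\<close>

lemma cross3_parallel: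
  fixes P Q f :: "nat \<Rightarrow> 'b::comm_ring"
  assumes "dot3 P f = 0" "dot3 Q f = 0" "i < 3" "k < 3"
  shows "cross3 P Q i * f k = cross3 P Q k * f i"
proof -
  have "cross3 P Q 0 * f 1 - cross3 P Q 1 * f 0 = dot3 P f * Q 2 - dot3 Q f * P 2"
       "cross3 P Q 1 * f 2 - cross3 P Q 2 * f 1 = dot3 P f * Q 0 - dot3 Q f * P 0"
       "cross3 P Q 2 * f 0 - cross3 P Q 0 * f 2 = dot3 P f * Q 1 - dot3 Q f * P 1"
    by (simp_all add: dot3_def algebra_simps)
  then show ?thesis using assms by (elim less_3_cases) simp_all
qed

lemma coeff_mult_degree_le:
  fixes p q :: "'a::comm_semiring_0 poly"
  assumes "degree p \<le> m" "degree q \<le> n"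
  shows "coeff (p * q) (m + n) = coeff p m * coeff q n"
proof (cases "degree p = m \<and> degree q = n")
  case True
  then show ?thesis using coeff_mult_degree_sum by blast
next
  case False
  then have lt: "degree p + degree q < m + n" using assms by linarith
  then have "coeff (p * q) (m + n) = 0"
    using degree_mult_le[of p q] by (intro coeff_eq_0) linarith
  moreover have "coeff p m * coeff q n = 0"
    using lt coeff_eq_0[of p m] coeff_eq_0[of q n] by (cases "degree p < m") auto
  ultimately show ?thesis by simp
qed

lemma degree_le_pred_if_coeff_0:
  assumes "degree p \<le> m" "coeff p m = 0" "m > 0"
  shows "degree p \<le> m - 1"
proof (rule degree_le, intro allI impI)
  fix i assume "m - 1 < i"
  then have "i = m \<or> i > m" using \<open>m > 0\<close> by linarith
  then show "coeff p i = 0" using assms by (auto intro: coeff_eq_0)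
qed

lemma degree_le_pred_if_linear_mult:
  fixes p :: "'a::field poly"
  assumes "degree ([:-r, 1:] * p) \<le> m"
  shows "degree p \<le> m - 1"
proof (cases "p = 0")
  case False
  then have "degree ([:-r, 1:] * p) = Suc (degree p)" by (subst degree_mult_eq) auto
  then show ?thesis using assms by simp
qed simp

text \<open>Induction on the degree of \<open>f k\<close>. At a root \<open>r\<close> of
  \<open>f k\<close> some \<open>f j\<close> does not vanish, so proportionality forces
  \<open>N k\<close> to vanish at \<open>r\<close> too, and the linear factor cancels from both.
  When \<open>f k\<close> is a constant, \<open>u\<close> is \<open>N k\<close> divided by
  it.\<close>

lemma parallel_imp_multiple:
  fixes f N :: "nat \<Rightarrow> 'a::alg_closed_field poly"
  assumes "f k \<noteq> 0" and "\<forall>i<m. N i * f k = N k * f i"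
    and "\<forall>r. \<exists>i<m. poly (f i) r \<noteq> 0" and "k < m"
  shows "\<exists>u. \<forall>i<m. N i = u * f i"
  using assms
proof (induction "degree (f k)" arbitrary: f N)
  case 0
  then obtain c where c: "f k = [:c:]" "c \<noteq> 0" by (metis degree_0_id pCons_0_0)
  have "N i = Polynomial.smult (inverse c) (N k) * f i" if "i < m" for i
  proof -
    have "Polynomial.smult c (N i) = N k * f i" using 0(3) that by (simp add: c mult.commute)
    then have "Polynomial.smult (inverse c) (Polynomial.smult c (N i)) = Polynomial.smult (inverse c) (N k * f i)" by simp
    then show ?thesis using c by simp
  qed
  then show ?case by blast
next
  case (Suc n)
  obtain r where r: "poly (f k) r = 0"
    using alg_closed_imp_poly_has_root[of "f k"] Suc.hyps(2) by auto
  then obtain g where g: "f k = [:-r, 1:] * g" by (auto simp: poly_eq_0_iff_dvd)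
  have "g \<noteq> 0" using g Suc.prems by auto
  have "degree (f k) = Suc (degree g)" unfolding g by (subst degree_mult_eq) (use \<open>g \<noteq> 0\<close> in auto)
  then have dg: "degree g = n" using Suc.hyps by simp
  obtain j where j: "j < m" "poly (f j) r \<noteq> 0" using Suc.prems by blast
  have "poly (N j) r * poly (f k) r = poly (N k) r * poly (f j) r"
    using Suc.prems j by (metis poly_mult)
  then have "poly (N k) r = 0" using r j by simp
  then obtain M where M: "N k = [:-r, 1:] * M" by (auto simp: poly_eq_0_iff_dvd)
  \<comment> \<open>Dividing only the components at \<open>k\<close> by the linear factor preserves
    the proportionality and the absence of common roots, and it does not change the multiplier
    \<open>u\<close>.\<close>
  have "\<exists>u. \<forall>i<m. (N(k := M)) i = u * (f(k := g)) i"
  proof (rule Suc.hyps(1))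
    show "\<forall>i<m. (N(k := M)) i * (f(k := g)) k = (N(k := M)) k * (f(k := g)) i"
    proof (intro allI impI)
      fix i assume "i < m"
      then have "[:-r, 1:] * (N i * g) = [:-r, 1:] * (M * f i)"
        using Suc.prems(2) unfolding g M by (simp only: ac_simps)
      then have "N i * g = M * f i" by (subst (asm) mult_cancel_left) auto
      then show "(N(k := M)) i * (f(k := g)) k = (N(k := M)) k * (f(k := g)) i" by simp
    qed
    show "\<forall>r'. \<exists>i<m. poly ((f(k := g)) i) r' \<noteq> 0"
    proof
      fix r'
      obtain i where "i < m" "poly (f i) r' \<noteq> 0" using Suc.prems by blast
      then show "\<exists>i<m. poly ((f(k := g)) i) r' \<noteq> 0" by (cases "i = k") (auto simp: g)
    qed
  qed (use dg \<open>g \<noteq> 0\<close> \<open>k < m\<close> in auto)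
  then obtain u where u: "\<And>i. i < m \<Longrightarrow> (N(k := M)) i = u * (f(k := g)) i" by blast
  have "N i = u * f i" if "i < m" for i
  proof (cases "i = k")
    case True
    then have "M = u * g" using u[OF that] by simp
    then show ?thesis by (simp only: True g M mult.left_commute)
  qed (use u[OF that] in simp)
  then show ?case by blast
qed

text \<open>The Koszul syzygies \<open>K k\<close>, cross products of the unit vectors with
  \<open>f\<close>, are the rows of a skew-symmetric matrix whose principal 2 by 2 minors are the
  squares of the \<open>f i\<close>. If all rows were multiples of one \<open>P\<close>, these
  minors would vanish.\<close>

lemma exists_syzygy_not_multiple:
  fixes f P :: "nat \<Rightarrow> 'b::idom"
  assumes "\<exists>i<3. f i \<noteq> 0"
  shows "\<exists>A. dot3 A f = 0 \<and> \<not> (\<exists>u. \<forall>i<3. A i = u * P i)"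
proof (rule ccontr)
  assume *: "\<not> ?thesis"
  define K where "K k = cross3 (\<lambda>i. if i = k then 1 else 0) f" for k
  have "\<exists>u. \<forall>i<3. K k i = u * P i" if "k < 3" for k
  proof -
    have "dot3 (K k) f = 0" by (simp add: dot3_def K_def algebra_simps)
    then show ?thesis using * by blast
  qed
  then have "\<forall>k. \<exists>u. k < 3 \<longrightarrow> (\<forall>i<3. K k i = u * P i)" by blast
  then obtain u where u: "\<forall>k. k < 3 \<longrightarrow> (\<forall>i<3. K k i = u k * P i)" by (rule choice[THEN exE])
  have "f 2 * f 2 = K 0 0 * K 1 1 - K 0 1 * K 1 0"
       "f 0 * f 0 = K 1 1 * K 2 2 - K 1 2 * K 2 1"
       "f 1 * f 1 = K 2 2 * K 0 0 - K 2 0 * K 0 2" by (simp_all add: K_def)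
  moreover have "K i i * K j j - K i j * K j i = 0" if "i < 3" "j < 3" for i j
    using u that by simp
  ultimately have "f 0 = 0" "f (Suc 0) = 0" "f 2 = 0" by simp_all
  then show False using assms by (simp add: ex_less_3)
qed

lemma exists_degree_bound_3: "\<exists>m. \<forall>i<3::nat. degree (A i) \<le> m"
  by (rule exI[of _ "degree (A 0) + degree (A (Suc 0)) + degree (A 2)"]) (simp add: all_less_3)

text \<open>\<open>top\<close> and \<open>root\<close> say that the forms belonging to
  \<open>f\<close> have no common zero, at infinity and at the finite points. The last conclusion is
  the minimality of \<open>b\<close>; it later determines the kernel of the matrix.\<close>

lemma mu_basis:
  fixes f :: "nat \<Rightarrow> 'a::alg_closed_field poly"
  assumes deg: "\<forall>i<3. degree (f i) \<le> d" and top: "\<exists>i<3. coeff (f i) d \<noteq> 0"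
    and root: "\<forall>r. \<exists>i<3. poly (f i) r \<noteq> 0"
  obtains P Q a b where "a + b = d" "a \<le> b"
    "\<forall>i<3. degree (P i) \<le> a" "\<forall>i<3. degree (Q i) \<le> b" "\<exists>i<3. coeff (P i) a \<noteq> 0"
    "\<forall>i<3. cross3 P Q i = f i"
    "\<forall>A. dot3 A f = 0 \<longrightarrow> (\<forall>i<3. degree (A i) < b) \<longrightarrow> (\<exists>u. \<forall>i<3. A i = u * P i)"
proof -
  define syz where "syz m A \<longleftrightarrow> dot3 A f = 0 \<and> (\<forall>i<3. degree (A i) \<le> m)" for m A
  define nz where "nz A \<longleftrightarrow> (\<exists>i<3. A i \<noteq> 0)" for A :: "nat \<Rightarrow> 'a poly"
  define mult where "mult P A \<longleftrightarrow> (\<exists>u. \<forall>i<3. A i = u * P i)" for P A :: "nat \<Rightarrow> 'a poly"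
  have f_nz: "\<exists>i<3. f i \<noteq> 0" using top by force
  have ex_min: "\<exists>m A. syz m A \<and> \<not> mult P A" for P
    using exists_syzygy_not_multiple[OF f_nz, of P] exists_degree_bound_3
    unfolding syz_def mult_def by blast
  have nz_if: "nz A" if "\<not> mult P A" for P A
  proof (rule ccontr)
    assume "\<not> nz A"
    then have "\<forall>i<3. A i = 0 * P i" by (simp add: nz_def)
    then show False using that unfolding mult_def by blast
  qed
  have ex_nz: "\<exists>m A. syz m A \<and> nz A" using ex_min[of "\<lambda>_. 0"] nz_if by blast

  define a where "a = (LEAST m. \<exists>A. syz m A \<and> nz A)"
  have "\<exists>A. syz a A \<and> nz A" unfolding a_def by (rule LeastI_ex) (rule ex_nz)
  then obtain P where P: "syz a P" "nz P" by blast
  have a_le: "a \<le> m" if "syz m A" "nz A" for m A unfolding a_def by (rule Least_le) (use that in blast)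

  define b where "b = (LEAST m. \<exists>A. syz m A \<and> \<not> mult P A)"
  have "\<exists>A. syz b A \<and> \<not> mult P A" unfolding b_def by (rule LeastI_ex) (rule ex_min)
  then obtain Q where Q: "syz b Q" "\<not> mult P Q" by blast
  have b_le: "b \<le> m" if "syz m A" "\<not> mult P A" for m A unfolding b_def by (rule Least_le) (use that in blast)
  have ab: "a \<le> b" using a_le[OF Q(1)] nz_if Q(2) by blast

  \<comment> \<open>The alternative covers \<open>m = 0\<close>, where \<open>m - 1\<close> is not
    smaller than \<open>m\<close>: there the triple is zero.\<close>
  have lower: "syz (m - 1) A \<and> m > 0 \<or> \<not> nz A" if "syz m A" "\<forall>i<3. coeff (A i) m = 0" for m A
  proof (cases "m > 0")
    case True
    then show ?thesis using that degree_le_pred_if_coeff_0 unfolding syz_def by blast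
  next
    case False
    have "A i = 0" if "i < 3" for i
    proof -
      have "degree (A i) = 0" using \<open>syz m A\<close> False that by (simp add: syz_def)
      then show ?thesis using \<open>\<forall>i<3. coeff (A i) m = 0\<close> False that leading_coeff_0_iff[of "A i"] by simp
    qed
    then show ?thesis unfolding nz_def by blast
  qed
  obtain k where k: "k < 3" "coeff (P k) a \<noteq> 0"
  proof -
    have "\<not> (syz (a - 1) P \<and> a > 0)" using a_le[of "a - 1" P] P(2) by linarith
    then show ?thesis using lower[OF P(1)] P(2) that by blast
  qed

  have lead: "\<exists>i<3. cross3 (\<lambda>i. coeff (P i) a) (\<lambda>i. coeff (Q i) b) i \<noteq> 0"
  proof (rule ccontr)
    assume "\<not> ?thesis"
    then have *: "\<forall>i<3. cross3 (\<lambda>i. coeff (P i) a) (\<lambda>i. coeff (Q i) b) i = 0" by blast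
    \<comment> \<open>If the leading vectors are dependent, \<open>c\<close> is their ratio, and
      \<open>Q - c s^(b-a) P\<close> loses its coefficients at \<open>b\<close>. It is still a
      syzygy that is no multiple of \<open>P\<close>, which contradicts the choice of
      \<open>b\<close>.\<close>
    define c where "c = coeff (Q k) b / coeff (P k) a"
    have c: "coeff (Q i) b = c * coeff (P i) a" if "i < 3" for i
    proof -
      have "coeff (Q i) b * coeff (P k) a = coeff (Q k) b * coeff (P i) a"
        using * that k(1) unfolding all_less_3 cross3_simps
        by (elim less_3_cases; simp add: mult.commute)
      then show ?thesis using k(2) by (simp add: c_def field_simps)
    qed
    define A where "A i = Q i - monom c (b - a) * P i" for i
    have "syz b A"
    proof -
      have "dot3 A f = dot3 Q f - monom c (b - a) * dot3 P f"
        by (simp add: dot3_def A_def algebra_simps)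
      moreover have "degree (A i) \<le> b" if "i < 3" for i
      proof -
        have "degree (monom c (b - a) * P i) \<le> (b - a) + a"
          using P(1) that unfolding syz_def
          by (meson add_mono degree_monom_le degree_mult_le order_trans)
        then show ?thesis using Q(1) that ab unfolding syz_def A_def
          by (intro degree_diff_le) auto
      qed
      ultimately show ?thesis using P(1) Q(1) by (simp add: syz_def)
    qed
    moreover have "coeff (A i) b = 0" if "i < 3" for i
      using c[OF that] ab by (simp add: A_def coeff_monom_mult)
    ultimately have "syz (b - 1) A \<and> b > 0 \<or> \<not> nz A" using lower by blast
    moreover have "\<not> mult P A"
    proof
      assume "mult P A"
      then obtain u where "\<forall>i<3. A i = u * P i" unfolding mult_def by blast
      then have "\<forall>i<3. Q i = (u + monom c (b - a)) * P i" by (simp add: A_def algebra_simps)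
      then show False using Q(2) unfolding mult_def by blast
    qed
    ultimately show False using b_le[of "b - 1" A] nz_if by force
  qed

  define N where "N = cross3 P Q"
  have N_lead: "coeff (N i) (a + b) = cross3 (\<lambda>i. coeff (P i) a) (\<lambda>i. coeff (Q i) b) i" for i
    using P(1) Q(1) unfolding N_def cross3_def syz_def by (simp add: coeff_mult_degree_le)
  have N_deg: "degree (N i) \<le> a + b" for i
  proof -
    have "degree (P x * Q y) \<le> a + b" if "x < 3" "y < 3" for x y
      using P(1) Q(1) that degree_mult_le[of "P x" "Q y"] unfolding syz_def
      by (meson add_mono order_trans)
    then show ?thesis unfolding N_def cross3_def by (intro degree_diff_le) auto
  qed
  obtain k' where k': "k' < 3" "f k' \<noteq> 0" using f_nz by blast
  have "\<exists>u. \<forall>i<3. N i = u * f i"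
  proof (rule parallel_imp_multiple[OF k'(2) _ root k'(1)])
    show "\<forall>i<3. N i * f k' = N k' * f i"
      using P(1) Q(1) k'(1) unfolding N_def syz_def by (blast intro: cross3_parallel)
  qed
  then obtain u where u: "\<forall>i<3. N i = u * f i" by blast

  \<comment> \<open>At a root \<open>r\<close> of \<open>u\<close> the vectors \<open>P(r)\<close>
    and \<open>Q(r)\<close> are dependent. A combination vanishing at \<open>r\<close> can be
    divided by \<open>s - r\<close>, and the quotient is a syzygy with a smaller degree
    bound.\<close>
  have "degree u = 0"
  proof (rule ccontr)
    assume "degree u \<noteq> 0"
    then obtain r where r: "poly u r = 0" using alg_closed_imp_poly_has_root by blast
    have split: "\<exists>A. (\<forall>i<3. B i = [:-r, 1:] * A i) \<and> (syz (m - 1) A \<and> m > 0 \<or> \<not> nz A)"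
      if B: "syz m B" "\<forall>i<3. poly (B i) r = 0" for m B
    proof -
      define A where "A i = B i div [:-r, 1:]" for i
      have A: "\<forall>i<3. B i = [:-r, 1:] * A i"
        using B(2) unfolding A_def poly_eq_0_iff_dvd by (simp del: mult_pCons_left)
      have "[:-r, 1:] * dot3 A f = dot3 B f"
        unfolding dot3_def using A by (simp add: all_less_3 distrib_left mult.assoc del: mult_pCons_left)
      then have "[:-r, 1:] * dot3 A f = 0" using B(1) unfolding syz_def by (simp del: mult_pCons_left)
      then have "dot3 A f = 0" by (simp del: mult_pCons_left)
      moreover have "degree (A i) \<le> m - 1" if "i < 3" for i
        using B(1) A that by (intro degree_le_pred_if_linear_mult[of r]) (auto simp: syz_def simp del: mult_pCons_left)
      moreover have "A i = 0" if "m = 0" "i < 3" for i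
      proof (rule ccontr)
        assume "A i \<noteq> 0"
        then have "degree (B i) = Suc (degree (A i))"
          using A that by (simp add: degree_mult_eq del: mult_pCons_left)
        then show False using B(1) that by (simp add: syz_def)
      qed
      ultimately show ?thesis using A unfolding syz_def nz_def by blast
    qed
    show False
    proof (cases "\<forall>i<3. poly (P i) r = 0")
      case True
      then obtain A where A: "\<forall>i<3. P i = [:-r, 1:] * A i" "syz (a - 1) A \<and> a > 0 \<or> \<not> nz A"
        using split[OF P(1)] by blast
      have "nz A" using A(1) P(2) unfolding nz_def by auto
      then show False using A(2) a_le[of "a - 1" A] by fastforce
    next
      case False
      then obtain l where l: "l < 3" "poly (P l) r \<noteq> 0" by blast
      \<comment> \<open>With these coefficients component \<open>l\<close> of \<open>B\<close>
        vanishes at \<open>r\<close> trivially, and the others because their values are, up to sign,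
        components of \<open>N\<close> at \<open>r\<close>. As \<open>\<beta> \<noteq> 0\<close>,
        \<open>Q\<close> can be recovered from \<open>B\<close>, so the quotient of \<open>B\<close>
        is no multiple of \<open>P\<close>.\<close>
      define \<alpha> \<beta> where "\<alpha> = - poly (Q l) r" and "\<beta> = poly (P l) r"
      define B where "B i = [:\<alpha>:] * P i + [:\<beta>:] * Q i" for i
      have "\<forall>i<3. poly (N i) r = 0" using u r by simp
      then have "\<forall>i<3. poly (B i) r = 0"
        using l(1) unfolding N_def
        unfolding all_less_3 B_def \<alpha>_def \<beta>_def
        by (elim less_3_cases; simp add: all_less_3 mult.commute)
      moreover have "syz b B"
      proof -
        have "dot3 B f = [:\<alpha>:] * dot3 P f + [:\<beta>:] * dot3 Q f"
          by (simp add: dot3_def B_def smult_add_right distrib_right)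
        moreover have "degree (B i) \<le> b" if "i < 3" for i
          unfolding B_def using P(1) Q(1) ab that
          by (intro degree_add_le) (auto simp: syz_def intro: order_trans[OF degree_smult_le])
        ultimately show ?thesis using P(1) Q(1) by (simp add: syz_def)
      qed
      ultimately obtain A where A: "\<forall>i<3. B i = [:-r, 1:] * A i" "syz (b - 1) A \<and> b > 0 \<or> \<not> nz A"
        using split by blast
      have "\<not> mult P A"
      proof
        assume "mult P A"
        then obtain v where v: "\<forall>i<3. A i = v * P i" unfolding mult_def by blast
        have "Q i = [:inverse \<beta>:] * ([:-r, 1:] * v - [:\<alpha>:]) * P i" if "i < 3" for i
        proof -
          have "[:\<beta>:] * Q i = ([:-r, 1:] * v - [:\<alpha>:]) * P i"
            using A(1) v that unfolding B_def by (simp add: algebra_simps)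
          then have "[:inverse \<beta>:] * ([:\<beta>:] * Q i) = [:inverse \<beta>:] * (([:-r, 1:] * v - [:\<alpha>:]) * P i)"
            by (rule arg_cong)
          then show ?thesis using l(2) by (simp add: \<beta>_def mult.assoc)
        qed
        then show False using Q(2) unfolding mult_def by blast
      qed
      then show False using A(2) b_le[of "b - 1" A] nz_if by fastforce
    qed
  qed
  then obtain c where c: "u = [:c:]" by (rule degree_eq_zeroE)
  have N_eq: "\<forall>i<3. N i = Polynomial.smult c (f i)" using u c by simp
  have "c \<noteq> 0" using lead N_lead[symmetric] N_eq by auto
  \<comment> \<open>\<open>N\<close> is a nonzero multiple of \<open>f\<close>; \<open>N\<close> has
    a nonzero coefficient at its degree bound \<open>a + b\<close>, and \<open>f\<close> has one at
    its degree bound \<open>d\<close>.\<close>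
  have "a + b \<le> d"
  proof -
    obtain i where i: "i < 3" "coeff (N i) (a + b) \<noteq> 0" using lead N_lead by auto
    then have "coeff (f i) (a + b) \<noteq> 0" using N_eq by force
    then show ?thesis using deg i(1) le_degree order_trans by blast
  qed
  moreover have "d \<le> a + b"
  proof -
    obtain i where i: "i < 3" "coeff (f i) d \<noteq> 0" using top by blast
    then have "coeff (N i) d \<noteq> 0" using N_eq \<open>c \<noteq> 0\<close> by simp
    then show ?thesis using N_deg le_degree order_trans by blast
  qed
  \<comment> \<open>Scaling \<open>Q\<close> absorbs the constant \<open>c\<close>; \<open>P\<close>
    and its multiples stay the same.\<close>
  moreover have "\<forall>i<3. cross3 P (\<lambda>i. Polynomial.smult (inverse c) (Q i)) i = f i"
  proof (intro allI impI)
    fix i :: nat assume "i < 3"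
    have "cross3 P (\<lambda>i. Polynomial.smult (inverse c) (Q i)) i = Polynomial.smult (inverse c) (N i)"
      by (simp add: cross3_def N_def smult_diff_right)
    then show "cross3 P (\<lambda>i. Polynomial.smult (inverse c) (Q i)) i = f i"
      using N_eq \<open>c \<noteq> 0\<close> \<open>i < 3\<close> by simp
  qed
  moreover have "\<forall>A. dot3 A f = 0 \<longrightarrow> (\<forall>i<3. degree (A i) < b) \<longrightarrow> (\<exists>u. \<forall>i<3. A i = u * P i)"
  proof (intro allI impI, rule ccontr)
    fix A assume A: "dot3 A f = 0" "\<forall>i<3. degree (A i) < b" "\<not> (\<exists>u. \<forall>i<3. A i = u * P i)"
    then have "\<not> mult P A" by (simp add: mult_def)
    moreover have "b > 0" using A(2) by (auto simp: all_less_3)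
    moreover have "syz (b - 1) A" using A by (fastforce simp: syz_def)
    ultimately show False using b_le[of "b - 1" A] by simp
  qed
  moreover have "\<forall>i<3. degree (P i) \<le> a" "\<forall>i<3. degree (Polynomial.smult (inverse c) (Q i)) \<le> b"
    using P(1) Q(1) by (auto simp: syz_def intro: order_trans[OF degree_smult_le])
  ultimately show ?thesis
    using k ab by (intro that[of a b P "\<lambda>i. Polynomial.smult (inverse c) (Q i)"]) auto
qed

section \<open>Binary forms and twisting sheaves\<close>

text \<open>This is \<open>t^k p(s/t)\<close>. Coefficients of \<open>p\<close> beyond degree
  \<open>k\<close> are dropped, so it is faithful only where \<open>k\<close> bounds the
  degree.\<close>

definition homogenize :: "nat \<Rightarrow> 'a::comm_semiring_1 poly \<Rightarrow> 'a poly poly" where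
  "homogenize k p = (\<Sum>i\<le>k. monom (monom (coeff p i) i) (k - i))"

lemma coeff_homogenize:
  "coeff (coeff (homogenize k p) j) i = (if i + j = k then coeff p i else 0)"
proof -
  have "coeff (coeff (homogenize k p) j) i = (\<Sum>n\<le>k. if n = i then if k - n = j then coeff p n else 0 else 0)"
    unfolding homogenize_def coeff_sum by (intro sum.cong) auto
  then show ?thesis by (auto simp: sum.delta)
qed

lemma homogenize_add: "homogenize k (p + q) = homogenize k p + homogenize k q"
  by (simp add: poly_eq_iff coeff_homogenize)

lemma homogenize_diff:
  fixes p :: "'a::comm_ring_1 poly"
  shows "homogenize k (p - q) = homogenize k p - homogenize k q"
  by (simp add: poly_eq_iff coeff_homogenize)

lemma homogenize_0 [simp]: "homogenize k 0 = 0"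
  by (simp add: poly_eq_iff coeff_homogenize)

lemma homogenize_sum: "homogenize k (\<Sum>x\<in>X. p x) = (\<Sum>x\<in>X. homogenize k (p x))"
  by (induction X rule: infinite_finite_induct) (simp_all add: homogenize_add)

lemma homogenize_monom:
  assumes "i \<le> k"
  shows "homogenize k (monom c i) = monom (monom c i) (k - i)"
  using assms by (auto simp: poly_eq_iff coeff_homogenize)

lemma homogenize_mult:
  fixes p q :: "'a::comm_semiring_1 poly"
  assumes "degree p \<le> m" "degree q \<le> n"
  shows "homogenize (m + n) (p * q) = homogenize m p * homogenize n q"
proof -
  have "p * q = (\<Sum>i\<le>m. \<Sum>j\<le>n. monom (coeff p i * coeff q j) (i + j))"
    unfolding mult_monom[symmetric] sum_product[symmetric]
    by (simp only: poly_as_sum_of_monoms'[OF assms(1)] poly_as_sum_of_monoms'[OF assms(2)])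
  then have "homogenize (m + n) (p * q) =
      (\<Sum>i\<le>m. \<Sum>j\<le>n. homogenize (m + n) (monom (coeff p i * coeff q j) (i + j)))"
    by (simp add: homogenize_sum)
  also have "\<dots> = (\<Sum>i\<le>m. \<Sum>j\<le>n. monom (monom (coeff p i) i) (m - i) * monom (monom (coeff q j) j) (n - j))"
    by (intro sum.cong) (auto simp: homogenize_monom mult_monom)
  also have "\<dots> = homogenize m p * homogenize n q"
    by (simp add: homogenize_def sum_product)
  finally show ?thesis .
qed

lemma homogeneous_homogenize: "homogeneous k (homogenize k p)"
  by (simp add: homogeneous_def coeff_homogenize)

text \<open>Setting \<open>t = 1\<close> inverts \<open>homogenize\<close>, since in degree
  \<open>k\<close> the power of \<open>s\<close> determines that of \<open>t\<close>. Questions on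
  binary forms thus become questions on polynomials in one variable.\<close>

lemma homogeneousE:
  fixes g :: "'a::comm_semiring_1 poly poly"
  assumes "homogeneous k g"
  obtains p where "degree p \<le> k" "g = homogenize k p"
proof
  define p where "p = (\<Sum>i\<le>k. monom (coeff (coeff g (k - i)) i) i)"
  show "degree p \<le> k" unfolding p_def
    by (intro degree_sum_le) (auto intro: order_trans[OF degree_monom_le])
  have "coeff p i = (if i \<le> k then coeff (coeff g (k - i)) i else 0)" for i
    by (simp add: p_def coeff_sum sum.delta)
  then show "g = homogenize k p"
    using assms by (auto simp: poly_eq_iff coeff_homogenize homogeneous_def)
qed

lemma homogeneous_0 [simp]: "homogeneous k 0"
  by (simp add: homogeneous_def)

lemma homogeneous_add:
  fixes f g :: "'a::comm_semiring_1 poly poly"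
  shows "homogeneous k f \<Longrightarrow> homogeneous k g \<Longrightarrow> homogeneous k (f + g)"
  by (elim homogeneousE) (simp add: homogenize_add[symmetric] homogeneous_homogenize)

lemma homogeneous_mult:
  fixes f g :: "'a::comm_semiring_1 poly poly"
  shows "homogeneous k f \<Longrightarrow> homogeneous l g \<Longrightarrow> homogeneous (k + l) (f * g)"
  by (elim homogeneousE) (simp add: homogenize_mult[symmetric] homogeneous_homogenize)

lemma homogeneous_const: "homogeneous 0 [:[:c:]:]"
  by (auto simp: homogeneous_def coeff_pCons split: nat.splits)

lemma homogeneous_1: "homogeneous 0 (1 :: 'a::comm_semiring_1 poly poly)"
  using homogeneous_const[of 1] by (simp add: one_pCons)

lemma homogeneous_power:
  fixes f :: "'a::comm_semiring_1 poly poly"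
  shows "homogeneous k f \<Longrightarrow> homogeneous (k * e) (f ^ e)"
  by (induction e) (auto simp: homogeneous_1 dest: homogeneous_mult)

lemma eval2_0 [simp]: "eval2 0 v = 0"
  by (simp add: eval2_def)

lemma eval2_1 [simp]: "eval2 1 v = 1"
  by (simp add: eval2_def)

lemma eval2_mult: "eval2 (f * g) v = eval2 f v * eval2 g v"
  by (simp add: eval2_def)

lemma eval2_power: "eval2 (f ^ e) v = eval2 f v ^ e"
  by (simp add: eval2_def)

lemma eval2_sum: "eval2 (\<Sum>x\<in>X. f x) v = (\<Sum>x\<in>X. eval2 (f x) v)"
  by (simp add: eval2_def poly_sum)

lemma eval2_homogenize:
  "eval2 (homogenize k p) v = (\<Sum>i\<le>k. coeff p i * vec_index v 0 ^ i * vec_index v 1 ^ (k - i))"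
  by (simp add: homogenize_def eval2_sum) (simp add: eval2_def poly_monom poly_power ac_simps)

abbreviation affine_vec :: "'a::field \<Rightarrow> 'a vec" where
  "affine_vec r \<equiv> vec 2 (\<lambda>i. if i = 0 then r else 1)"

abbreviation infinity_vec :: "'a::field vec" where
  "infinity_vec \<equiv> vec 2 (\<lambda>i. if i = 0 then 1 else 0)"

lemma eval2_homogenize_affine:
  assumes "degree p \<le> k"
  shows "eval2 (homogenize k p) (affine_vec r) = poly p r"
proof -
  have "poly p r = poly (\<Sum>i\<le>k. monom (coeff p i) i) r"
    by (simp only: poly_as_sum_of_monoms'[OF assms])
  then show ?thesis by (simp add: eval2_homogenize poly_sum poly_monom)
qed

lemma eval2_homogenize_infinity:
  "eval2 (homogenize k p) infinity_vec = coeff p k"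
proof -
  have "eval2 (homogenize k p) infinity_vec = (\<Sum>i\<le>k. if i = k then coeff p i else 0)"
    unfolding eval2_homogenize by (intro sum.cong) (auto simp: power_0_left)
  then show ?thesis by simp
qed

lemma eval2_smult:
  assumes "homogeneous k f" "v \<in> carrier_vec 2"
  shows "eval2 f (c \<cdot>\<^sub>v v) = c ^ k * eval2 f v"
proof -
  obtain p where p: "f = homogenize k p" by (rule homogeneousE[OF assms(1)])
  have "coeff p i * vec_index (c \<cdot>\<^sub>v v) 0 ^ i * vec_index (c \<cdot>\<^sub>v v) 1 ^ (k - i) =
      c ^ k * (coeff p i * vec_index v 0 ^ i * vec_index v 1 ^ (k - i))" if "i \<le> k" for i
  proof -
    have "c ^ k = c ^ i * c ^ (k - i)" using that by (simp add: power_add[symmetric])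
    then show ?thesis using assms(2) by (simp add: power_mult_distrib ac_simps)
  qed
  then show ?thesis
    unfolding p eval2_homogenize sum_distrib_left by (intro sum.cong) simp_all
qed

section \<open>Points and principal open sets of the projective line\<close>

lemma P1_E:
  assumes "P \<in> P1"
  obtains v where "v \<in> carrier_vec 2" "v \<noteq> 0\<^sub>v 2" "P = proj_point v" "v \<in> P"
proof -
  obtain v where v: "v \<in> carrier_vec 2" "v \<noteq> 0\<^sub>v 2" "P = proj_point v"
    using assms by (auto simp: proj_space_def numeral_2_eq_2)
  moreover have "v = 1 \<cdot>\<^sub>v v" by simp
  then have "v \<in> P" unfolding v(3) proj_point_def by (metis (mono_tags, lifting) mem_Collect_eq zero_neq_one)
  ultimately show ?thesis using that by blast
qed

lemma proj_point_in_P1: "v \<in> carrier_vec 2 \<Longrightarrow> v \<noteq> 0\<^sub>v 2 \<Longrightarrow> proj_point v \<in> P1"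
  by (auto simp: proj_space_def numeral_2_eq_2)

lemma affine_vec_in_P1: "proj_point (affine_vec r) \<in> P1"
  by (rule proj_point_in_P1) (auto simp: vec_eq_iff)

lemma infinity_vec_in_P1: "proj_point infinity_vec \<in> P1"
  by (rule proj_point_in_P1) (auto simp: vec_eq_iff)

lemma proj_point_self: "v \<in> proj_point v"
  unfolding proj_point_def by (auto intro: exI[of _ 1])

text \<open>Rescaling a representative multiplies the value of a form by a nonzero power, so one
  representative decides.\<close>

lemma proj_point_in_principal_open:
  assumes "homogeneous k f" "v \<in> carrier_vec 2" "proj_point v \<in> P1" "eval2 f v \<noteq> 0"
  shows "proj_point v \<in> principal_open f"
  using assms by (auto simp: principal_open_def proj_point_def eval2_smult)

lemma principal_open_subset: "principal_open f \<subseteq> P1"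
  by (auto simp: principal_open_def)

lemma principal_open_mult: "principal_open (f * g) = principal_open f \<inter> principal_open g"
  by (auto simp: principal_open_def eval2_mult)

lemma principal_open_1: "principal_open 1 = P1"
  by (auto simp: principal_open_def)

lemma nonzero_if_in_principal_open: "P \<in> principal_open f \<Longrightarrow> f \<noteq> 0"
proof
  assume P: "P \<in> principal_open f" and "f = 0"
  have "P \<in> P1" using P principal_open_subset by blast
  then obtain v where "v \<in> P" by (rule P1_E)
  moreover have "\<forall>v\<in>P. eval2 f v \<noteq> 0" using P by (simp add: principal_open_def)
  ultimately show False using \<open>f = 0\<close> by force
qed

lemma zariski_open_principal_open: "homogeneous k f \<Longrightarrow> zariski_open (principal_open f)"
  unfolding zariski_open_def by (intro exI[of _ "{f}"]) auto

lemma zariski_open_subset: "zariski_open U \<Longrightarrow> U \<subseteq> P1"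
  using principal_open_subset by (fastforce simp: zariski_open_def)

section \<open>Regular sections of the twisting sheaves\<close>

lemma twistI:
  assumes "\<And>P. P \<in> U \<Longrightarrow> \<exists>V. P \<in> V \<and> f \<in> twist m V"
  shows "f \<in> twist m U"
  using assms by (fastforce simp: twist_def)

lemma twist_mono: "f \<in> twist m U \<Longrightarrow> V \<subseteq> U \<Longrightarrow> f \<in> twist m V"
  by (auto simp: twist_def)

lemma twist_Fract:
  assumes "homogeneous k g" "homogeneous l h" "int k = int l + m" "U \<subseteq> principal_open h"
  shows "Fract g h \<in> twist m U"
  using assms unfolding twist_def by blast

lemma twist_form:
  assumes "homogeneous k g" "U \<subseteq> P1"
  shows "Fract g 1 \<in> twist (int k) U"
  using assms by (intro twist_Fract[OF _ homogeneous_1]) (auto simp: principal_open_1)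

lemma twist_add:
  assumes "f \<in> twist m U" "g \<in> twist m U"
  shows "f + g \<in> twist m U"
  unfolding twist_def mem_Collect_eq
proof
  fix P assume "P \<in> U"
  then obtain a b k l a' b' k' l' where *:
    "homogeneous k a" "homogeneous l b" "int k = int l + m" "P \<in> principal_open b" "f = Fract a b"
    "homogeneous k' a'" "homogeneous l' b'" "int k' = int l' + m" "P \<in> principal_open b'" "g = Fract a' b'"
    using assms unfolding twist_def by blast
  \<comment> \<open>The two terms of the numerator over the common denominator have equal
    degree.\<close>
  then have eq: "k' + l = k + l'" by linarith
  have "homogeneous (k + l') (a * b' + a' * b)"
    using homogeneous_mult[OF *(1,7)] homogeneous_mult[OF *(6,2)] unfolding eq by (rule homogeneous_add)
  moreover have "homogeneous (l + l') (b * b')" using *(2,7) by (rule homogeneous_mult)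
  moreover have "P \<in> principal_open (b * b')" using * by (simp add: principal_open_mult)
  moreover have "int (k + l') = int (l + l') + m" using * by simp
  moreover have "f + g = Fract (a * b' + a' * b) (b * b')"
    using nonzero_if_in_principal_open[OF *(4)] nonzero_if_in_principal_open[OF *(9)]
    by (simp add: *(5,10) mult.commute)
  ultimately show "\<exists>g' h k l. homogeneous k g' \<and> homogeneous l h \<and> int k = int l + m \<and>
      P \<in> principal_open h \<and> f + g = Fract g' h" by blast
qed

lemma twist_mult:
  assumes "f \<in> twist m U" "g \<in> twist m' U"
  shows "f * g \<in> twist (m + m') U"
  unfolding twist_def mem_Collect_eq
proof
  fix P assume "P \<in> U"
  then obtain a b k l a' b' k' l' where *:
    "homogeneous k a" "homogeneous l b" "int k = int l + m" "P \<in> principal_open b" "f = Fract a b"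
    "homogeneous k' a'" "homogeneous l' b'" "int k' = int l' + m'" "P \<in> principal_open b'" "g = Fract a' b'"
    using assms unfolding twist_def by blast
  have "homogeneous (k + k') (a * a')" "homogeneous (l + l') (b * b')"
    using * homogeneous_mult by blast+
  moreover have "P \<in> principal_open (b * b')" using * by (simp add: principal_open_mult)
  moreover have "int (k + k') = int (l + l') + (m + m')" using * by simp
  moreover have "f * g = Fract (a * a') (b * b')" using * by simp
  ultimately show "\<exists>g' h k l. homogeneous k g' \<and> homogeneous l h \<and> int k = int l + (m + m') \<and>
      P \<in> principal_open h \<and> f * g = Fract g' h" by blast
qed

lemma twist_uminus:
  assumes "f \<in> twist m U" "U \<subseteq> P1"
  shows "- f \<in> twist m U"
proof -
  have "Fract [:[:-1:]:] 1 \<in> twist 0 U"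
    using twist_form[OF homogeneous_const assms(2)] by simp
  moreover have "Fract [:[:-1:]:] 1 = - (1 :: 'a rat)"
    by (simp add: One_fract_def one_pCons)
  ultimately show ?thesis using twist_mult[OF assms(1), of "- 1" 0] by simp
qed

lemma twist_diff:
  "f \<in> twist m U \<Longrightarrow> g \<in> twist m U \<Longrightarrow> U \<subseteq> P1 \<Longrightarrow> f - g \<in> twist m U"
  using twist_add[OF _ twist_uminus, of f m U g] by simp

definition form_s :: "'a::comm_semiring_1 poly poly" where "form_s = homogenize 1 [:0, 1:]"

definition form_t :: "'a::comm_semiring_1 poly poly" where "form_t = homogenize 1 1"

lemma homogeneous_form_s: "homogeneous 1 form_s" and homogeneous_form_t: "homogeneous 1 form_t"
  by (simp_all only: form_s_def form_t_def homogeneous_homogenize)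

lemma eval2_form_s: "eval2 form_s v = vec_index v 0" and eval2_form_t: "eval2 form_t v = vec_index v 1"
  by (simp_all add: form_s_def form_t_def eval2_homogenize)

lemma P1_subset_st: "P1 \<subseteq> principal_open form_s \<union> principal_open (form_t :: 'a::field poly poly)"
proof
  fix P :: "'a vec set" assume P: "P \<in> P1"
  then obtain v where v: "v \<in> carrier_vec 2" "v \<noteq> 0\<^sub>v 2" "P = proj_point v" by (rule P1_E)
  then have "vec_index v 0 \<noteq> 0 \<or> vec_index v 1 \<noteq> 0"
    by (auto simp: vec_eq_iff numeral_2_eq_2 less_Suc_eq)
  then show "P \<in> principal_open form_s \<union> principal_open form_t"
    using proj_point_in_principal_open[OF homogeneous_form_s v(1)]
      proj_point_in_principal_open[OF homogeneous_form_t v(1)] P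
    unfolding v(3) eval2_form_s eval2_form_t by blast
qed

text \<open>A presentation of 0 still needs degrees that differ by \<open>m\<close>. On a chart
  \<open>h \<noteq> 0\<close> the denominator \<open>h ^ nat (- m)\<close> serves, with 0 regarded
  as a form of degree \<open>nat m\<close>.\<close>

lemma twist_0:
  assumes "U \<subseteq> P1"
  shows "0 \<in> twist m U"
proof (rule twistI)
  fix P assume "P \<in> U"
  then consider "P \<in> principal_open form_s" | "P \<in> principal_open form_t"
    using assms P1_subset_st by blast
  moreover have "0 \<in> twist m (principal_open h)" if "homogeneous 1 h" for h :: "'a poly poly"
  proof -
    have "homogeneous (nat (- m)) (h ^ nat (- m))" using homogeneous_power[OF that] by simp
    moreover have "principal_open h \<subseteq> principal_open (h ^ nat (- m))"
      by (auto simp: principal_open_def eval2_power)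
    moreover have "int (nat m) = int (nat (- m)) + m" by linarith
    ultimately have "Fract 0 (h ^ nat (- m)) \<in> twist m (principal_open h)"
      by (intro twist_Fract[OF homogeneous_0])
    then show ?thesis by (simp add: fract_collapse)
  qed
  ultimately show "\<exists>V. P \<in> V \<and> 0 \<in> twist m V"
    using homogeneous_form_s homogeneous_form_t by blast
qed

text \<open>Write \<open>f\<close> as \<open>g / h\<close>. Regularity everywhere makes
  \<open>g\<close> vanish wherever \<open>h\<close> does, so common linear factors can be cancelled
  until \<open>h\<close> has degree 0; then \<open>g\<close> would have the negative degree
  \<open>m\<close>.\<close>

lemma twist_negative_P1:
  fixes f :: "'a::alg_closed_field rat"
  assumes f: "f \<in> twist m P1" and "m < 0"
  shows "f = 0"
proof -
  \<comment> \<open>Compare with a presentation \<open>g' / h'\<close> whose denominator does not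
    vanish at \<open>v\<close>, by evaluating \<open>g h' = g' h\<close>.\<close>
  have vanish: "eval2 g v = 0"
    if "proj_point v \<in> P1" "f = Fract g h" "h \<noteq> 0" "eval2 h v = 0" for g h v
  proof -
    have "\<forall>P\<in>P1. \<exists>g h. P \<in> principal_open h \<and> f = Fract g h"
      using f unfolding twist_def by blast
    from bspec[OF this that(1)]
    obtain g' h' where *: "proj_point v \<in> principal_open h'" "f = Fract g' h'"
      by blast
    have "h' \<noteq> 0" using * nonzero_if_in_principal_open by blast
    then have "g * h' = g' * h" using *(2) that(2,3) by (simp add: eq_fract)
    then have "eval2 (g * h') v = eval2 (g' * h) v" by (rule arg_cong)
    then have "eval2 g v * eval2 h' v = eval2 g' v * eval2 h v" by (simp only: eval2_mult)
    moreover have "eval2 h' v \<noteq> 0" using *(1) proj_point_self by (auto simp: principal_open_def)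
    ultimately show ?thesis using that(4) by simp
  qed
  have main: "f = 0"
    if "homogeneous k g" "homogeneous l h" "h \<noteq> 0" "int k = int l + m" "f = Fract g h" for k l g h
    using that
  proof (induction l arbitrary: k g h)
    case 0
    then show ?case using \<open>m < 0\<close> by simp
  next
    case (Suc l)
    obtain p where p: "degree p \<le> k" "g = homogenize k p" using Suc.prems by (elim homogeneousE)
    obtain q where q: "degree q \<le> Suc l" "h = homogenize (Suc l) q" using Suc.prems by (elim homogeneousE)
    \<comment> \<open>Cancels the linear form belonging to \<open>w\<close>. A numerator of degree 0
      has no such factor to lose; vanishing at one point makes it 0.\<close>
    have step: "f = 0" if w: "degree w \<le> 1" "p = w * p'" "q = w * q'" "degree p' \<le> k - 1" "degree q' \<le> l"
        and "k = 0 \<Longrightarrow> p = 0" for w p' q'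
    proof (cases "k = 0")
      case True
      then show ?thesis using that p Suc.prems by (simp add: fract_collapse)
    next
      case False
      have g: "g = homogenize 1 w * homogenize (k - 1) p'"
        using homogenize_mult[OF w(1,4)] False by (simp add: p(2) w(2))
      have h: "h = homogenize 1 w * homogenize l q'"
        using homogenize_mult[OF w(1,5)] by (simp add: q(2) w(3))
      show ?thesis
      proof (rule Suc.IH)
        show "homogenize l q' \<noteq> 0" using h Suc.prems by auto
        show "f = Fract (homogenize (k - 1) p') (homogenize l q')"
          using Suc.prems(3,5) unfolding g h by (subst (asm) mult_fract_cancel) auto
        show "homogeneous (k - 1) (homogenize (k - 1) p')" "homogeneous l (homogenize l q')"
          by (rule homogeneous_homogenize)+
        show "int (k - 1) = int l + m" using False Suc.prems(4) by simp
      qed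
    qed
    show ?case
    proof (cases "degree q = 0")
      case False
      then obtain r where r: "poly q r = 0" using alg_closed_imp_poly_has_root by blast
      have "eval2 g (affine_vec r) = 0"
        by (rule vanish[OF affine_vec_in_P1 Suc.prems(5,3)])
          (use r q(1) in \<open>simp add: q(2) eval2_homogenize_affine\<close>)
      then have "poly p r = 0" using p by (simp add: eval2_homogenize_affine)
      then obtain p' where p': "p = [:-r, 1:] * p'" by (auto simp: poly_eq_0_iff_dvd)
      obtain q' where q': "q = [:-r, 1:] * q'" using r by (auto simp: poly_eq_0_iff_dvd)
      show ?thesis
      proof (rule step[OF _ p' q'])
        show "degree p' \<le> k - 1" using p(1) unfolding p' by (rule degree_le_pred_if_linear_mult)
        show "degree q' \<le> l" using degree_le_pred_if_linear_mult[of r q' "Suc l"] q(1) unfolding q' by simp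
        show "p = 0" if "k = 0" using \<open>poly p r = 0\<close> p(1) that by (auto elim: degree_eq_zeroE)
      qed simp
    next
      case True
      \<comment> \<open>For constant \<open>q\<close> the denominator is a constant times a power of
        \<open>t\<close>. Its zero is the point at infinity, and the factor to cancel is
        \<open>t\<close>, which belongs to \<open>w = 1\<close>.\<close>
      have "eval2 g infinity_vec = 0"
        by (rule vanish[OF infinity_vec_in_P1 Suc.prems(5,3)])
          (use True in \<open>simp add: q(2) eval2_homogenize_infinity coeff_eq_0\<close>)
      then have "coeff p k = 0" by (simp add: p eval2_homogenize_infinity)
      show ?thesis
      proof (rule step[of 1 p q])
        show "degree p \<le> k - 1"
          using p(1) \<open>coeff p k = 0\<close> degree_le_pred_if_coeff_0 by (cases "k = 0") auto
        show "p = 0" if "k = 0" using \<open>coeff p k = 0\<close> p(1) that by (auto elim: degree_eq_zeroE)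
      qed (use True in auto)
    qed
  qed
  have "\<forall>P\<in>P1. \<exists>g h k l. homogeneous k g \<and> homogeneous l h \<and> int k = int l + m \<and>
      P \<in> principal_open h \<and> f = Fract g h"
    using f by (simp only: twist_def mem_Collect_eq)
  from bspec[OF this infinity_vec_in_P1] obtain g h k l where "homogeneous k g" "homogeneous l h" "int k = int l + m"
      "proj_point infinity_vec \<in> principal_open h" "f = Fract g h"
    by blast
  then show ?thesis using main nonzero_if_in_principal_open by blast
qed

section \<open>The sheaf of syzygies and its splitting type\<close>

lemma dot3_eq_sum: "dot3 A B = (\<Sum>j<3. A j * B j)"
  by (simp add: dot3_def eval_nat_numeral)

lemma dot3_cross3: "dot3 p (cross3 p q) = 0" "dot3 q (cross3 p q) = 0"
  by (simp_all add: dot3_def algebra_simps)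

lemma dot3_cong: "(\<And>i. i < 3 \<Longrightarrow> A i = A' i) \<Longrightarrow> (\<And>i. i < 3 \<Longrightarrow> B i = B' i) \<Longrightarrow> dot3 A B = dot3 A' B'"
  by (simp add: dot3_eq_sum)

text \<open>Cramer's rule. For \<open>i \<noteq> j\<close> it is an identity; for
  \<open>i = j\<close> the two sides differ by the determinant of \<open>A\<close>,
  \<open>p\<close>, \<open>q\<close>, which is \<open>dot3 A (cross3 p q)\<close>.\<close>

lemma cramer3:
  assumes "dot3 A (cross3 p q) = 0" "i < 3" "j < 3"
  shows "cross3 p q i * A j = cross3 A q i * p j + cross3 p A i * q j"
proof -
  have "cross3 p q i * A j - (cross3 A q i * p j + cross3 p A i * q j)
      = (if i = j then dot3 A (cross3 p q) else 0)"
    using assms(2,3) by (elim less_3_cases; simp add: dot3_def algebra_simps)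
  then show ?thesis using assms(1) by (simp split: if_splits)
qed

text \<open>The Euler sequence in coordinates. Since
  \<open>x i d(x j / x i) = dx j - (x j / x i) dx i\<close>, a combination of these with
  coefficients \<open>A j\<close> is the sum of all \<open>A j dx j\<close>, provided that
  \<open>A\<close> is orthogonal to \<open>x\<close>. Hence the components of a syzygy are its
  coordinates on every chart; the case \<open>l = i\<close> recovers the component that the
  \<open>i\<close>-th chart omits.\<close>

lemma cotangent_transition_sum:
  fixes x :: "nat \<Rightarrow> 'b::field"
  assumes "dot3 A x = 0" "x i \<noteq> 0" "x k \<noteq> 0" "i < 3" "l < 3"
  shows "(\<Sum>j\<in>{..<3} - {i}. A j * (x i / x k * cotangent_transition x i k j l)) = A l"
proof (cases "l = i")
  case True
  have "(\<Sum>j\<in>{..<3} - {i}. A j * (x i / x k * cotangent_transition x i k j l))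
      = (\<Sum>j\<in>{..<3} - {i}. - (A j * x j) / x i)"
    using assms True
    by (intro sum.cong) (auto simp: cotangent_transition_def field_simps power2_eq_square)
  also have "\<dots> = - (\<Sum>j\<in>{..<3} - {i}. A j * x j) / x i"
    by (simp only: sum_negf sum_divide_distrib[symmetric])
  also have "(\<Sum>j\<in>{..<3} - {i}. A j * x j) = - (A i * x i)"
    using assms(1,4) unfolding dot3_eq_sum
    by (subst (asm) sum.remove[of _ i]) (auto simp: eq_neg_iff_add_eq_0 add.commute)
  finally show ?thesis using assms True by simp
next
  case False
  have "(\<Sum>j\<in>{..<3} - {i}. A j * (x i / x k * cotangent_transition x i k j l))
      = (\<Sum>j\<in>{..<3} - {i}. if j = l then A j else 0)"
    using assms False by (intro sum.cong) (auto simp: cotangent_transition_def)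
  also have "\<dots> = A l" using False assms by (simp add: sum.delta')
  finally show ?thesis .
qed

text \<open>The explicit map \<open>\<Psi>\<close> goes out of \<open>F\<close> and is one formula
  for all open sets. Its inverses on the various \<open>U\<close> agree under restriction because
  restrictions are inclusions; they are linear because \<open>F\<close> is closed under the module
  operations and \<open>\<Psi>\<close> is injective.\<close>

lemma sheaf_iso_if_inverse:
  fixes E :: "('a::field, 'i) sheaf" and F :: "('a, 'j) sheaf"
  assumes bij: "\<And>U. zariski_open U \<Longrightarrow> U \<noteq> {} \<Longrightarrow> bij_betw \<Psi> (F U) (E U)"
    and add: "\<And>\<sigma> \<tau>. \<Psi> (\<lambda>i. \<sigma> i + \<tau> i) = (\<lambda>j. \<Psi> \<sigma> j + \<Psi> \<tau> j)"
    and scale: "\<And>f \<sigma>. \<Psi> (\<lambda>i. f * \<sigma> i) = (\<lambda>j. f * \<Psi> \<sigma> j)"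
    and F_add: "\<And>U \<sigma> \<tau>. \<sigma> \<in> F U \<Longrightarrow> \<tau> \<in> F U \<Longrightarrow> (\<lambda>i. \<sigma> i + \<tau> i) \<in> F U"
    and F_scale: "\<And>U f \<sigma>. f \<in> twist 0 U \<Longrightarrow> \<sigma> \<in> F U \<Longrightarrow> (\<lambda>i. f * \<sigma> i) \<in> F U"
    and F_mono: "\<And>U V. V \<subseteq> U \<Longrightarrow> F U \<subseteq> F V"
  shows "sheaf_iso E F"
  unfolding sheaf_iso_def
proof (rule exI[of _ "\<lambda>U. inv_into (F U) \<Psi>"], intro conjI allI impI ballI)
  fix U :: "'a vec set set" assume U: "zariski_open U \<and> U \<noteq> {}"
  then have b: "bij_betw \<Psi> (F U) (E U)" using bij by blast
  then have inj: "inj_on \<Psi> (F U)" by (rule bij_betw_imp_inj_on)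
  show "bij_betw (inv_into (F U) \<Psi>) (E U) (F U)" using b by (rule bij_betw_inv_into)
  have in_F: "inv_into (F U) \<Psi> \<sigma> \<in> F U" "\<Psi> (inv_into (F U) \<Psi> \<sigma>) = \<sigma>" if "\<sigma> \<in> E U" for \<sigma>
    using b that by (simp_all add: bij_betw_def inv_into_into f_inv_into_f)
  {
    fix \<sigma> \<tau> assume "\<sigma> \<in> E U" "\<tau> \<in> E U"
    then show "inv_into (F U) \<Psi> (\<lambda>i. \<sigma> i + \<tau> i) = (\<lambda>j. inv_into (F U) \<Psi> \<sigma> j + inv_into (F U) \<Psi> \<tau> j)"
      by (intro inv_into_f_eq inj F_add) (simp_all add: in_F add)
  next
    fix f \<sigma> assume "f \<in> twist 0 U" "\<sigma> \<in> E U"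
    then show "inv_into (F U) \<Psi> (\<lambda>i. f * \<sigma> i) = (\<lambda>j. f * inv_into (F U) \<Psi> \<sigma> j)"
      by (intro inv_into_f_eq inj F_scale) (simp_all add: in_F scale)
  }
next
  fix U V :: "'a vec set set" and \<sigma>
  assume UV: "zariski_open U \<and> zariski_open V \<and> V \<noteq> {} \<and> V \<subseteq> U" and "\<sigma> \<in> E U"
  then have b: "bij_betw \<Psi> (F U) (E U)" "bij_betw \<Psi> (F V) (E V)" using bij by blast+
  then have "\<sigma> \<in> \<Psi> ` F U" using \<open>\<sigma> \<in> E U\<close> by (simp add: bij_betw_def)
  then obtain \<tau> where \<tau>: "\<tau> \<in> F U" "\<Psi> \<tau> = \<sigma>" by blast
  moreover have "\<tau> \<in> F V" using \<tau> UV F_mono by blast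
  ultimately show "inv_into (F V) \<Psi> \<sigma> = inv_into (F U) \<Psi> \<sigma>"
    using b by (metis bij_betw_imp_inj_on inv_into_f_f)
qed

lemma sum_twists_add: "\<sigma> \<in> sum_twists m m' U \<Longrightarrow> \<tau> \<in> sum_twists m m' U \<Longrightarrow> (\<lambda>i. \<sigma> i + \<tau> i) \<in> sum_twists m m' U"
  by (auto simp: sum_twists_def intro: twist_add)

lemma sum_twists_scale: "f \<in> twist 0 U \<Longrightarrow> \<sigma> \<in> sum_twists m m' U \<Longrightarrow> (\<lambda>i. f * \<sigma> i) \<in> sum_twists m m' U"
  using twist_mult[of f 0 U] by (auto simp: sum_twists_def)

lemma sum_twists_mono: "V \<subseteq> U \<Longrightarrow> sum_twists m m' U \<subseteq> sum_twists m m' V"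
  by (auto simp: sum_twists_def intro: twist_mono)

lemma Fract_power: "Fract a b ^ m = Fract (a ^ m) (b ^ m)"
  by (induction m) (simp_all add: One_fract_def)

lemma Fract_1_eq_0_iff: "Fract a 1 = 0 \<longleftrightarrow> a = (0 :: 'b::idom)"
  by (simp add: Zero_fract_def eq_fract)

lemma mem_pullback_cotangent_twist_iff:
  "\<sigma> \<in> pullback_cotangent_twist \<phi> U \<longleftrightarrow>
    (\<forall>i j. i < 3 \<longrightarrow> \<phi> i \<noteq> 0 \<longrightarrow> j < 3 \<longrightarrow> j \<noteq> i \<longrightarrow> \<sigma> (i, j) \<in> twist 0 (U \<inter> principal_open (\<phi> i))) \<and>
    (\<forall>i j. \<not> (i < 3 \<and> \<phi> i \<noteq> 0 \<and> j < 3 \<and> j \<noteq> i) \<longrightarrow> \<sigma> (i, j) = 0) \<and>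
    (\<forall>i k l. i < 3 \<longrightarrow> \<phi> i \<noteq> 0 \<longrightarrow> k < 3 \<longrightarrow> \<phi> k \<noteq> 0 \<longrightarrow> l < 3 \<longrightarrow> l \<noteq> k \<longrightarrow>
      \<sigma> (k, l) = (\<Sum>j\<in>{..<3} - {i}. \<sigma> (i, j) *
        (Fract (\<phi> i) 1 / Fract (\<phi> k) 1 * cotangent_transition (\<lambda>i. Fract (\<phi> i) 1) i k j l)))"
  unfolding pullback_cotangent_twist_def Let_def by (simp add: Ball_def imp_conjL del: divide_fract)

lemma pullback_cotangent_twist_iso:
  fixes \<phi> p q :: "nat \<Rightarrow> 'a::field poly poly"
  assumes \<phi>: "\<And>i. i < 3 \<Longrightarrow> homogeneous (a + b) (\<phi> i)"
    and p: "\<And>i. i < 3 \<Longrightarrow> homogeneous a (p i)"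
    and q: "\<And>i. i < 3 \<Longrightarrow> homogeneous b (q i)"
    and pq: "\<And>i. i < 3 \<Longrightarrow> cross3 p q i = \<phi> i"
    and nz: "\<And>P. P \<in> P1 \<Longrightarrow> \<exists>i<3. P \<in> principal_open (\<phi> i)"
  shows "sheaf_iso (pullback_cotangent_twist \<phi>) (sum_twists (- int a) (- int b))"
proof -
  define x where "x i = Fract (\<phi> i) 1" for i
  define p' where "p' i = Fract (p i) 1" for i
  define q' where "q' i = Fract (q i) 1" for i
  have x_nz: "x i \<noteq> 0 \<longleftrightarrow> \<phi> i \<noteq> 0" for i by (simp add: x_def Fract_1_eq_0_iff)
  have x: "cross3 p' q' i = x i" if "i < 3" for i
    using pq[OF that] by (simp add: cross3_def p'_def q'_def x_def)
  have dot_x: "dot3 A (cross3 p' q') = dot3 A x" for A by (rule dot3_cong) (simp_all add: x)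
  \<comment> \<open>The coordinate at \<open>(i, j)\<close> is component \<open>j\<close> of the
    syzygy, whatever the chart \<open>i\<close>; this is consistent by
    \<open>cotangent_transition_sum\<close>.\<close>
  define \<Psi> where "\<Psi> \<tau> = (\<lambda>(i, j). if i < 3 \<and> \<phi> i \<noteq> 0 \<and> j < 3 \<and> j \<noteq> i then \<tau> 0 * p' j + \<tau> 1 * q' j else 0)"
    for \<tau> :: "nat \<Rightarrow> 'a rat"
  note E_iff = mem_pullback_cotangent_twist_iff[of _ \<phi>, folded x_def]
  have form_p: "p' j \<in> twist (int a) V" and form_q: "q' j \<in> twist (int b) V"
    if "j < 3" "V \<subseteq> P1" for j V
    unfolding p'_def q'_def using twist_form that p q by blast+
  have in_E: "\<Psi> \<tau> \<in> pullback_cotangent_twist \<phi> U" if \<tau>: "\<tau> \<in> sum_twists (- int a) (- int b) U" and "U \<subseteq> P1" for \<tau> U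
    unfolding E_iff
  proof (intro conjI allI impI)
    fix i j :: nat
    assume ij: "i < 3" "\<phi> i \<noteq> 0" "j < 3" "j \<noteq> i"
    have "\<tau> 0 * p' j + \<tau> 1 * q' j \<in> twist 0 U"
      using \<tau> twist_mult[of "\<tau> 0" "- int a" U "p' j" "int a"] twist_mult[of "\<tau> 1" "- int b" U "q' j" "int b"]
        form_p[OF ij(3) that(2)] form_q[OF ij(3) that(2)]
      by (intro twist_add) (auto simp: sum_twists_def)
    then show "\<Psi> \<tau> (i, j) \<in> twist 0 (U \<inter> principal_open (\<phi> i))"
      using ij by (auto simp: \<Psi>_def intro: twist_mono)
  next
    fix i j assume "\<not> (i < 3 \<and> \<phi> i \<noteq> 0 \<and> j < 3 \<and> j \<noteq> i)"
    then show "\<Psi> \<tau> (i, j) = 0" by (auto simp: \<Psi>_def)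
  next
    fix i k l :: nat
    assume *: "i < 3" "\<phi> i \<noteq> 0" "k < 3" "\<phi> k \<noteq> 0" "l < 3" "l \<noteq> k"
    define A where "A j = \<tau> 0 * p' j + \<tau> 1 * q' j" for j
    have "dot3 A x = \<tau> 0 * dot3 p' x + \<tau> 1 * dot3 q' x"
      by (simp add: dot3_def A_def algebra_simps)
    then have "dot3 A x = 0" using dot3_cross3(1)[of p' q'] dot3_cross3(2)[of q' p'] by (simp add: dot_x)
    then have "(\<Sum>j\<in>{..<3} - {i}. A j * (x i / x k * cotangent_transition x i k j l)) = A l"
      using * by (intro cotangent_transition_sum) (simp_all add: x_nz)
    moreover have "(\<Sum>j\<in>{..<3} - {i}. \<Psi> \<tau> (i, j) * (x i / x k * cotangent_transition x i k j l))
        = (\<Sum>j\<in>{..<3} - {i}. A j * (x i / x k * cotangent_transition x i k j l))"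
      using * by (intro sum.cong) (auto simp: \<Psi>_def A_def)
    ultimately show "\<Psi> \<tau> (k, l) = (\<Sum>j\<in>{..<3} - {i}. \<Psi> \<tau> (i, j) * (x i / x k * cotangent_transition x i k j l))"
      using * by (simp add: \<Psi>_def A_def)
  qed
  obtain i0 where i0: "i0 < 3" "\<phi> i0 \<noteq> 0"
    using nz[OF infinity_vec_in_P1] nonzero_if_in_principal_open by blast
  have inj: "inj_on \<Psi> (sum_twists (- int a) (- int b) U)" for U
  proof (rule inj_onI)
    fix \<tau> \<tau>' assume \<tau>: "\<tau> \<in> sum_twists (- int a) (- int b) U" "\<tau>' \<in> sum_twists (- int a) (- int b) U" "\<Psi> \<tau> = \<Psi> \<tau>'"
    define u v where "u = \<tau> 0 - \<tau>' 0" and "v = \<tau> 1 - \<tau>' 1"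
    have *: "u * p' j + v * q' j = 0" if "j < 3" "j \<noteq> i0" for j
      using fun_cong[OF \<tau>(3), of "(i0, j)"] that i0 by (simp add: \<Psi>_def u_def v_def algebra_simps)
    \<comment> \<open>The two components visible on chart \<open>i0\<close> give a linear system for
      \<open>u\<close> and \<open>v\<close> with determinant \<open>x i0 \<noteq> 0\<close>.\<close>
    define j k where "j = (i0 + 1) mod 3" and "k = (i0 + 2) mod 3"
    have jk: "j < 3" "j \<noteq> i0" "k < 3" "k \<noteq> i0" unfolding j_def k_def using i0(1) by (elim less_3_cases; simp)+
    have D: "p' j * q' k - p' k * q' j = x i0" using x[OF i0(1)] by (simp add: cross3_def j_def k_def)
    have "u * x i0 = (u * p' j + v * q' j) * q' k - (u * p' k + v * q' k) * q' j"
         "v * x i0 = (u * p' k + v * q' k) * p' j - (u * p' j + v * q' j) * p' k"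
      unfolding D[symmetric] by (simp_all add: algebra_simps)
    then have "u = 0" "v = 0" using *[OF jk(1,2)] *[OF jk(3,4)] i0(2) x_nz by auto
    show "\<tau> = \<tau>'"
    proof
      fix i :: nat
      consider "i = 0" | "i = 1" | "i \<ge> 2" by linarith
      then show "\<tau> i = \<tau>' i"
        using \<open>u = 0\<close> \<open>v = 0\<close> \<tau>(1,2) by cases (auto simp: u_def v_def sum_twists_def)
    qed
  qed
  have surj: "\<sigma> \<in> \<Psi> ` sum_twists (- int a) (- int b) U"
    if \<sigma>: "\<sigma> \<in> pullback_cotangent_twist \<phi> U" and U: "U \<subseteq> P1" for \<sigma> U
  proof -
    \<comment> \<open>Chart \<open>i0\<close> supplies two components of the syzygy; the third is
      solved from \<open>dot3 A x = 0\<close>.\<close>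
    define A where "A j = (if j = i0 then - (\<Sum>j\<in>{..<3} - {i0}. \<sigma> (i0, j) * x j) / x i0 else \<sigma> (i0, j))" for j
    have "dot3 A x = A i0 * x i0 + (\<Sum>j\<in>{..<3} - {i0}. A j * x j)"
      unfolding dot3_eq_sum using i0(1) by (intro sum.remove) auto
    also have "(\<Sum>j\<in>{..<3} - {i0}. A j * x j) = (\<Sum>j\<in>{..<3} - {i0}. \<sigma> (i0, j) * x j)"
      by (intro sum.cong) (auto simp: A_def)
    also have "A i0 * x i0 = - (\<Sum>j\<in>{..<3} - {i0}. \<sigma> (i0, j) * x j)"
      using i0(2) x_nz by (simp add: A_def)
    finally have dot: "dot3 A x = 0" by simp
    have \<sigma>_A: "\<sigma> (k, l) = A l" if *: "k < 3" "\<phi> k \<noteq> 0" "l < 3" "l \<noteq> k" for k l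
    proof -
      have "\<sigma> (k, l) = (\<Sum>j\<in>{..<3} - {i0}. \<sigma> (i0, j) * (x i0 / x k * cotangent_transition x i0 k j l))"
        using \<sigma> * i0 unfolding E_iff by blast
      also have "\<dots> = (\<Sum>j\<in>{..<3} - {i0}. A j * (x i0 / x k * cotangent_transition x i0 k j l))"
        by (intro sum.cong) (auto simp: A_def)
      also have "\<dots> = A l" using dot * i0 by (intro cotangent_transition_sum) (simp_all add: x_nz)
      finally show ?thesis .
    qed
    \<comment> \<open>Cramer's rule read in component \<open>i0\<close>. Any other usable component
      gives the same ratios, as \<open>cross3 A q'\<close> and \<open>cross3 p' A\<close> are
      parallel to \<open>x\<close>; this is what makes them regular on all charts.\<close>
    define \<tau> where "\<tau> = (\<lambda>i::nat. if i = 0 then cross3 A q' i0 / x i0 else if i = 1 then cross3 p' A i0 / x i0 else 0)"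
    have A: "A j = \<tau> 0 * p' j + \<tau> 1 * q' j" if "j < 3" for j
    proof -
      have "x i0 * A j = cross3 A q' i0 * p' j + cross3 p' A i0 * q' j"
        using cramer3[of A p' q' i0 j] dot i0(1) that by (simp add: dot_x x)
      then show ?thesis using i0(2) x_nz[of i0] by (simp add: \<tau>_def field_simps)
    qed
    have dots: "dot3 p' x = 0" "dot3 q' x = 0" using dot3_cross3(1)[of p' q'] dot3_cross3(2)[of q' p'] by (simp_all add: dot_x)
    have \<tau>_eq: "\<tau> 0 = cross3 A q' i * Fract 1 (\<phi> i)" "\<tau> 1 = cross3 p' A i * Fract 1 (\<phi> i)"
      if "i < 3" "\<phi> i \<noteq> 0" for i
    proof -
      have inv: "Fract 1 (\<phi> i) = inverse (x i)" by (simp add: x_def)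
      show "\<tau> 0 = cross3 A q' i * Fract 1 (\<phi> i)" "\<tau> 1 = cross3 p' A i * Fract 1 (\<phi> i)"
        using cross3_parallel[OF dot dots(2) that(1) i0(1)] cross3_parallel[OF dots(1) dot that(1) i0(1)]
          x_nz[of i] x_nz[of i0] that i0
        by (simp_all add: inv \<tau>_def field_simps)
    qed
    \<comment> \<open>Component \<open>i\<close> of a cross product involves only components of
      \<open>A\<close> other than \<open>i\<close>, which are the regular coordinates on chart
      \<open>i\<close>. Division by \<open>\<phi> i\<close>, of degree \<open>a + b\<close>, turns
      the degrees \<open>b\<close> and \<open>a\<close> into \<open>-a\<close> and
      \<open>-b\<close>.\<close>
    have loc: "\<tau> 0 \<in> twist (- int a) (U \<inter> principal_open (\<phi> i))" "\<tau> 1 \<in> twist (- int b) (U \<inter> principal_open (\<phi> i))"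
      if i: "i < 3" "\<phi> i \<noteq> 0" for i
    proof -
      define V where "V = U \<inter> principal_open (\<phi> i)"
      have V: "V \<subseteq> P1" using U by (auto simp: V_def)
      have A_reg: "A j \<in> twist 0 V" if "j < 3" "j \<noteq> i" for j
        using \<sigma> \<sigma>_A[OF i that] i that unfolding E_iff V_def by metis
      have mod: "(i + 1) mod 3 < 3" "(i + 2) mod 3 < 3" "(i + 1) mod 3 \<noteq> i" "(i + 2) mod 3 \<noteq> i"
        using i(1) by (elim less_3_cases; simp)+
      have x_reg: "Fract 1 (\<phi> i) \<in> twist (- int (a + b)) V"
        using homogeneous_1 \<phi>[OF i(1)] by (rule twist_Fract) (auto simp: V_def)
      have "cross3 A q' i \<in> twist (0 + int b) V"
        unfolding cross3_def by (intro twist_diff twist_mult A_reg form_q mod V)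
      from twist_mult[OF this x_reg] show "\<tau> 0 \<in> twist (- int a) (U \<inter> principal_open (\<phi> i))"
        unfolding \<tau>_eq[OF i] V_def[symmetric] by simp
      have "cross3 p' A i \<in> twist (int a + 0) V"
        unfolding cross3_def by (intro twist_diff twist_mult A_reg form_p mod V)
      from twist_mult[OF this x_reg] show "\<tau> 1 \<in> twist (- int b) (U \<inter> principal_open (\<phi> i))"
        unfolding \<tau>_eq[OF i] V_def[symmetric] by simp
    qed
    have cover: "\<exists>i<3. \<phi> i \<noteq> 0 \<and> P \<in> U \<inter> principal_open (\<phi> i)" if "P \<in> U" for P
      using nz that U nonzero_if_in_principal_open by blast
    have "\<tau> 0 \<in> twist (- int a) U"
    proof (rule twistI)
      fix P assume "P \<in> U"
      then obtain i where "i < 3" "\<phi> i \<noteq> 0" "P \<in> U \<inter> principal_open (\<phi> i)" using cover by blast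
      then show "\<exists>V. P \<in> V \<and> \<tau> 0 \<in> twist (- int a) V" using loc(1) by blast
    qed
    moreover have "\<tau> 1 \<in> twist (- int b) U"
    proof (rule twistI)
      fix P assume "P \<in> U"
      then obtain i where "i < 3" "\<phi> i \<noteq> 0" "P \<in> U \<inter> principal_open (\<phi> i)" using cover by blast
      then show "\<exists>V. P \<in> V \<and> \<tau> 1 \<in> twist (- int b) V" using loc(2) by blast
    qed
    ultimately have "\<tau> \<in> sum_twists (- int a) (- int b) U" by (simp add: sum_twists_def \<tau>_def)
    moreover have "\<sigma> = \<Psi> \<tau>"
    proof
      fix ij :: "nat \<times> nat"
      obtain i j where ij: "ij = (i, j)" by (cases ij)
      show "\<sigma> ij = \<Psi> \<tau> ij"
      proof (cases "i < 3 \<and> \<phi> i \<noteq> 0 \<and> j < 3 \<and> j \<noteq> i")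
        case True
        then have "\<sigma> (i, j) = \<tau> 0 * p' j + \<tau> 1 * q' j" using \<sigma>_A[of i j] A[of j] by simp
        then show ?thesis using True by (simp only: ij \<Psi>_def prod.case if_True simp_thms)
      next
        case False
        then have "\<sigma> (i, j) = 0" using \<sigma> unfolding E_iff by blast
        then show ?thesis using False by (simp only: ij \<Psi>_def prod.case if_False)
      qed
    qed
    ultimately show ?thesis by blast
  qed
  show ?thesis
  proof (rule sheaf_iso_if_inverse[of \<Psi>])
    fix U :: "'a vec set set" assume "zariski_open U"
    then have "U \<subseteq> P1" by (rule zariski_open_subset)
    then show "bij_betw \<Psi> (sum_twists (- int a) (- int b) U) (pullback_cotangent_twist \<phi> U)"
      using inj in_E surj by (auto simp: bij_betw_def)
  qed (auto simp: \<Psi>_def fun_eq_iff algebra_simps intro: sum_twists_add sum_twists_scale dest: sum_twists_mono[THEN subsetD])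
qed

lemma pullback_cotangent_twist_0: "U \<subseteq> P1 \<Longrightarrow> (\<lambda>_. 0) \<in> pullback_cotangent_twist \<phi> U"
  by (auto simp: pullback_cotangent_twist_def intro!: twist_0)

lemma pullback_cotangent_twist_mono:
  assumes "V \<subseteq> U" "\<sigma> \<in> pullback_cotangent_twist \<phi> U"
  shows "\<sigma> \<in> pullback_cotangent_twist \<phi> V"
proof -
  have "g \<in> twist 0 (V \<inter> W)" if "g \<in> twist 0 (U \<inter> W)" for g W
    using that by (rule twist_mono) (use assms(1) in blast)
  then show ?thesis
    using assms(2) unfolding mem_pullback_cotangent_twist_iff
    by (elim conj_forward) (blast, assumption+)
qed

lemma pullback_cotangent_twist_scale:
  assumes f: "f \<in> twist 0 U" and \<sigma>: "\<sigma> \<in> pullback_cotangent_twist \<phi> U"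
  shows "(\<lambda>i. f * \<sigma> i) \<in> pullback_cotangent_twist \<phi> U"
  unfolding mem_pullback_cotangent_twist_iff
proof (intro conjI allI impI)
  fix i j :: nat assume "i < 3" "\<phi> i \<noteq> 0" "j < 3" "j \<noteq> i"
  then have "\<sigma> (i, j) \<in> twist 0 (U \<inter> principal_open (\<phi> i))"
    using \<sigma> unfolding mem_pullback_cotangent_twist_iff by blast
  from twist_mult[OF twist_mono[OF f] this]
  show "f * \<sigma> (i, j) \<in> twist 0 (U \<inter> principal_open (\<phi> i))" by simp
next
  fix i j assume "\<not> (i < 3 \<and> \<phi> i \<noteq> 0 \<and> j < 3 \<and> j \<noteq> i)"
  then have "\<sigma> (i, j) = 0" using \<sigma> unfolding mem_pullback_cotangent_twist_iff by blast
  then show "f * \<sigma> (i, j) = 0" by simp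
next
  fix i k l :: nat assume *: "i < 3" "\<phi> i \<noteq> 0" "k < 3" "\<phi> k \<noteq> 0" "l < 3" "l \<noteq> k"
  let ?c = "\<lambda>j. Fract (\<phi> i) 1 / Fract (\<phi> k) 1 * cotangent_transition (\<lambda>i. Fract (\<phi> i) 1) i k j l"
  have "\<sigma> (k, l) = (\<Sum>j\<in>{..<3} - {i}. \<sigma> (i, j) * ?c j)"
    using \<sigma> * unfolding mem_pullback_cotangent_twist_iff by blast
  then show "f * \<sigma> (k, l) = (\<Sum>j\<in>{..<3} - {i}. f * \<sigma> (i, j) * ?c j)"
    by (simp only: sum_distrib_left mult.assoc)
qed

text \<open>
  A global section of \<open>E(m)\<close>, given by its values on the two charts \<open>s \<noteq> 0\<close> and \<open>t \<noteq> 0\<close>,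
  which differ by the transition function \<open>(s / t)\<^sup>m\<close>.
\<close>

definition has_twisted_section :: "nat \<Rightarrow> ('a::field, 'i) sheaf \<Rightarrow> bool" where
  "has_twisted_section m E \<longleftrightarrow> (\<exists>\<sigma>\<in>E (principal_open form_s). \<sigma> \<noteq> (\<lambda>_. 0) \<and>
     (\<lambda>i. Fract form_s form_t ^ m * \<sigma> i) \<in> E (principal_open form_t))"

lemma form_s_nonzero: "(form_s :: 'a::field poly poly) \<noteq> 0" and form_t_nonzero: "(form_t :: 'a poly poly) \<noteq> 0"
proof -
  have "eval2 form_s (affine_vec 1) \<noteq> (0 :: 'a)" "eval2 form_t (affine_vec 1) \<noteq> (0 :: 'a)"
    by (simp_all add: eval2_form_s eval2_form_t)
  then show "(form_s :: 'a poly poly) \<noteq> 0" "(form_t :: 'a poly poly) \<noteq> 0" by auto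
qed

text \<open>The isomorphism is applied on the two charts separately. On their overlap
  \<open>(s / t)^m\<close> is a regular function, so there linearity and compatibility with
  restriction show that the gluing condition is respected.\<close>

lemma has_twisted_section_iso_iff:
  fixes E :: "('a::field, 'i) sheaf" and F :: "('a, 'j) sheaf"
  assumes iso: "sheaf_iso E F"
    and E_0: "\<And>U. U \<subseteq> P1 \<Longrightarrow> (\<lambda>_. 0) \<in> E U"
    and E_mono: "\<And>U V \<sigma>. V \<subseteq> U \<Longrightarrow> \<sigma> \<in> E U \<Longrightarrow> \<sigma> \<in> E V"
    and E_scale: "\<And>U f \<sigma>. f \<in> twist 0 U \<Longrightarrow> \<sigma> \<in> E U \<Longrightarrow> (\<lambda>i. f * \<sigma> i) \<in> E U"
  shows "has_twisted_section m E \<longleftrightarrow> has_twisted_section m F"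
proof -
  define S T ST :: "'a vec set set" where "S = principal_open form_s" and "T = principal_open form_t"
    and "ST = principal_open (form_s * form_t)"
  define f :: "'a rat" where "f = Fract form_s form_t ^ m"
  have sub: "ST \<subseteq> S" "ST \<subseteq> T" by (auto simp: S_def T_def ST_def principal_open_mult)
  have "proj_point (affine_vec 1) \<in> ST"
    unfolding ST_def by (rule proj_point_in_principal_open[OF homogeneous_mult[OF homogeneous_form_s homogeneous_form_t]])
      (rule affine_vec_in_P1 | simp add: eval2_mult eval2_form_s eval2_form_t)+
  then have ne: "S \<noteq> {}" "T \<noteq> {}" "ST \<noteq> {}" using sub by auto
  have op: "zariski_open S" "zariski_open T" "zariski_open ST"
    unfolding S_def T_def ST_def
    using homogeneous_form_s homogeneous_form_t homogeneous_mult zariski_open_principal_open by blast+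
  have "f = Fract (form_s ^ m) (form_t ^ m)"
    by (simp add: f_def Fract_power)
  moreover have "Fract (form_s ^ m) (form_t ^ m) \<in> twist 0 ST"
    using homogeneous_power[OF homogeneous_form_s] homogeneous_power[OF homogeneous_form_t]
    by (rule twist_Fract) (auto simp: ST_def principal_open_def eval2_mult eval2_power)
  ultimately have f: "f \<in> twist 0 ST" by simp
  obtain \<Phi> where
    \<Phi>: "\<forall>U. zariski_open U \<and> U \<noteq> {} \<longrightarrow>
        bij_betw (\<Phi> U) (E U) (F U) \<and>
        (\<forall>\<sigma>\<in>E U. \<forall>\<tau>\<in>E U. \<Phi> U (\<lambda>i. \<sigma> i + \<tau> i) = (\<lambda>j. \<Phi> U \<sigma> j + \<Phi> U \<tau> j)) \<and>
        (\<forall>f\<in>twist 0 U. \<forall>\<sigma>\<in>E U. \<Phi> U (\<lambda>i. f * \<sigma> i) = (\<lambda>j. f * \<Phi> U \<sigma> j))"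
    and res': "\<forall>U V. zariski_open U \<and> zariski_open V \<and> V \<noteq> {} \<and> V \<subseteq> U \<longrightarrow>
        (\<forall>\<sigma>\<in>E U. \<Phi> V \<sigma> = \<Phi> U \<sigma>)"
    using iso unfolding sheaf_iso_def by (elim exE conjE) (rule that)
  have bij: "bij_betw (\<Phi> U) (E U) (F U)" if "zariski_open U" "U \<noteq> {}" for U
    using \<Phi> that by simp
  have add: "\<Phi> U (\<lambda>i. \<sigma> i + \<tau> i) = (\<lambda>j. \<Phi> U \<sigma> j + \<Phi> U \<tau> j)"
    if "zariski_open U" "U \<noteq> {}" "\<sigma> \<in> E U" "\<tau> \<in> E U" for U \<sigma> \<tau>
    using \<Phi> that by simp
  have scale: "\<Phi> U (\<lambda>i. f * \<sigma> i) = (\<lambda>j. f * \<Phi> U \<sigma> j)"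
    if "zariski_open U" "U \<noteq> {}" "f \<in> twist 0 U" "\<sigma> \<in> E U" for U f \<sigma>
    using \<Phi> that by simp
  have res: "\<Phi> V \<sigma> = \<Phi> U \<sigma>"
    if "zariski_open U" "zariski_open V" "V \<noteq> {}" "V \<subseteq> U" "\<sigma> \<in> E U" for U V \<sigma>
    using res' that by blast
  have zero: "(\<lambda>_. 0) \<in> E S" using op(1) by (intro E_0 zariski_open_subset)
  have "\<Phi> S (\<lambda>_. 0) = (\<lambda>j. \<Phi> S (\<lambda>_. 0) j + \<Phi> S (\<lambda>_. 0) j)"
    using add[OF op(1) ne(1) zero zero] by simp
  then have \<Phi>_0: "\<Phi> S (\<lambda>_. 0) = (\<lambda>_. 0)" unfolding fun_eq_iff by (simp only: add_cancel_right_right simp_thms)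
  have inj: "inj_on (\<Phi> S) (E S)" "inj_on (\<Phi> ST) (E ST)"
    using bij op ne bij_betw_imp_inj_on by blast+
  have mem: "\<Phi> U \<sigma> \<in> F U" if "zariski_open U" "U \<noteq> {}" "\<sigma> \<in> E U" for U \<sigma>
    using bij[OF that(1,2)] that(3) by (auto simp: bij_betw_def)
  \<comment> \<open>\<open>f\<close> need not be regular on all of \<open>S\<close>, so
    \<open>\<sigma>\<close> is restricted to the overlap before scaling.\<close>
  have eq: "\<Phi> ST (\<lambda>i. f * \<sigma> i) = (\<lambda>j. f * \<Phi> S \<sigma> j)" if "\<sigma> \<in> E S" for \<sigma>
    using scale[OF op(3) ne(3) f E_mono[OF sub(1) that]] res[OF op(1,3) ne(3) sub(1) that] by simp
  show ?thesis
  proof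
    assume "has_twisted_section m E"
    then obtain \<sigma> where \<sigma>: "\<sigma> \<in> E S" "\<sigma> \<noteq> (\<lambda>_. 0)" "(\<lambda>i. f * \<sigma> i) \<in> E T"
      unfolding has_twisted_section_def S_def T_def f_def by blast
    have "\<Phi> S \<sigma> \<noteq> (\<lambda>_. 0)" using inj_onD[OF inj(1), of \<sigma> "\<lambda>_. 0"] \<sigma> zero \<Phi>_0 by auto
    moreover have "(\<lambda>j. f * \<Phi> S \<sigma> j) = \<Phi> T (\<lambda>i. f * \<sigma> i)"
      using eq[OF \<sigma>(1)] res[OF op(2,3) ne(3) sub(2) \<sigma>(3)] by simp
    ultimately show "has_twisted_section m F"
      using mem[OF op(1) ne(1) \<sigma>(1)] mem[OF op(2) ne(2) \<sigma>(3)]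
      unfolding has_twisted_section_def S_def T_def f_def by auto
  next
    assume "has_twisted_section m F"
    then obtain \<tau> where \<tau>: "\<tau> \<in> F S" "\<tau> \<noteq> (\<lambda>_. 0)" "(\<lambda>i. f * \<tau> i) \<in> F T"
      unfolding has_twisted_section_def S_def T_def f_def by blast
    have "\<tau> \<in> \<Phi> S ` E S" "(\<lambda>i. f * \<tau> i) \<in> \<Phi> T ` E T"
      using bij[OF op(1) ne(1)] bij[OF op(2) ne(2)] \<tau> by (simp_all add: bij_betw_def)
    then obtain \<sigma> \<rho> where \<sigma>: "\<sigma> \<in> E S" "\<Phi> S \<sigma> = \<tau>" and \<rho>: "\<rho> \<in> E T" "\<Phi> T \<rho> = (\<lambda>i. f * \<tau> i)"
      by (auto simp: image_iff)
    \<comment> \<open>The preimages on the two charts are chosen independently; injectivity on the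
      overlap makes them glue.\<close>
    have "\<Phi> ST \<rho> = \<Phi> ST (\<lambda>i. f * \<sigma> i)"
      using eq[OF \<sigma>(1)] res[OF op(2,3) ne(3) sub(2) \<rho>(1)] \<sigma>(2) \<rho>(2) by simp
    then have "\<rho> = (\<lambda>i. f * \<sigma> i)"
      by (rule inj_onD[OF inj(2)]) (use E_mono[OF sub(2) \<rho>(1)] E_scale[OF f E_mono[OF sub(1) \<sigma>(1)]] in auto)
    moreover have "\<sigma> \<noteq> (\<lambda>_. 0)" using \<tau>(2) \<sigma>(2) \<Phi>_0 by auto
    ultimately show "has_twisted_section m E"
      using \<sigma>(1) \<rho>(1) unfolding has_twisted_section_def S_def T_def f_def by blast
  qed
qed

text \<open>Multiplied by \<open>s^m\<close>, the section becomes regular of degree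
  \<open>k + m\<close> on both charts: on the second one \<open>s^m f\<close> is \<open>t^m\<close>
  times \<open>(s / t)^m f\<close>. It is then a global section of negative degree.\<close>

lemma twisted_section_twist_eq_0:
  fixes f :: "'a::alg_closed_field rat"
  assumes s: "f \<in> twist k (principal_open form_s)"
    and t: "Fract form_s form_t ^ m * f \<in> twist k (principal_open form_t)" and "k + int m < 0"
  shows "f = 0"
proof -
  have reg: "Fract (h ^ m) 1 \<in> twist (int m) U" if "homogeneous 1 h" "U \<subseteq> P1" for h :: "'a poly poly" and U
    using twist_form[OF homogeneous_power[OF that(1)] that(2)] by simp
  have "Fract (form_s ^ m) 1 * f \<in> twist (int m + k) (principal_open form_s)"
    using reg[OF homogeneous_form_s principal_open_subset] s by (rule twist_mult)
  moreover have "Fract (form_s ^ m) 1 * f \<in> twist (int m + k) (principal_open form_t)"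
  proof -
    have "Fract (form_s ^ m) 1 = Fract (form_t ^ m) 1 * Fract form_s (form_t :: 'a poly poly) ^ m"
      by (simp add: Fract_power eq_fract form_t_nonzero)
    then have "Fract (form_s ^ m) 1 * f = Fract (form_t ^ m) 1 * (Fract form_s form_t ^ m * f)"
      by (simp add: mult.assoc)
    also have "\<dots> \<in> twist (int m + k) (principal_open form_t)"
      using reg[OF homogeneous_form_t principal_open_subset] t by (rule twist_mult)
    finally show ?thesis .
  qed
  ultimately have "Fract (form_s ^ m) 1 * f \<in> twist (int m + k) P1"
    using P1_subset_st by (intro twistI) blast
  then have "Fract (form_s ^ m) 1 * f = 0" by (rule twist_negative_P1) (use assms(3) in simp)
  then show ?thesis by (simp add: Fract_1_eq_0_iff form_s_nonzero)
qed

lemma has_twisted_section_sum_twists: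
  fixes a b m :: nat
  assumes "a \<le> b"
  shows "has_twisted_section m (sum_twists (- int a) (- int b) :: ('a::alg_closed_field, nat) sheaf) \<longleftrightarrow> a \<le> m"
    (is "has_twisted_section m ?F \<longleftrightarrow> _")
proof
  assume "has_twisted_section m ?F"
  then obtain \<tau> where \<tau>: "\<tau> \<in> ?F (principal_open form_s)" "\<tau> \<noteq> (\<lambda>_. 0)"
      "(\<lambda>i. Fract form_s form_t ^ m * \<tau> i) \<in> ?F (principal_open form_t)"
    unfolding has_twisted_section_def by blast
  show "a \<le> m"
  proof (rule ccontr)
    assume "\<not> a \<le> m"
    then have "\<tau> 0 = 0" "\<tau> 1 = 0"
      using \<tau> assms twisted_section_twist_eq_0[of "\<tau> 0" "- int a" m] twisted_section_twist_eq_0[of "\<tau> 1" "- int b" m]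
      by (simp_all add: sum_twists_def)
    moreover have "\<tau> i = 0" if "i \<ge> 2" for i using \<tau>(1) that by (simp add: sum_twists_def)
    ultimately have "\<tau> i = 0" for i by (cases "i = 0 \<or> i = 1") auto
    then show False using \<tau>(2) by blast
  qed
next
  assume "a \<le> m"
  \<comment> \<open>The form \<open>s^(m-a)\<close>, a global section of the first summand twisted
    by \<open>m\<close>, reads \<open>s^(m-a) / s^m = 1 / s^a\<close> on the chart
    \<open>s \<noteq> 0\<close>.\<close>
  define \<tau> :: "nat \<Rightarrow> 'a rat" where "\<tau> = (\<lambda>i. if i = 0 then Fract 1 (form_s ^ a) else 0)"
  have \<tau>_eq_0: "\<tau> i = 0" if "i \<noteq> 0" for i using that by (simp add: \<tau>_def)
  have pow: "principal_open h \<subseteq> principal_open (h ^ e)" for h :: "'a poly poly" and e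
    by (auto simp: principal_open_def eval2_power)
  have "\<tau> 0 \<in> twist (- int a) (principal_open form_s)"
    unfolding \<tau>_def if_P[OF refl]
    using homogeneous_1 homogeneous_power[OF homogeneous_form_s] by (rule twist_Fract) (use pow in simp_all)
  moreover have "Fract form_s form_t ^ m * \<tau> 0 \<in> twist (- int a) (principal_open form_t)"
  proof -
    have "form_s ^ m = form_s ^ a * (form_s ^ (m - a) :: 'a poly poly)"
      using \<open>a \<le> m\<close> by (simp add: power_add[symmetric])
    then have "Fract form_s form_t ^ m * \<tau> 0 = Fract (form_s ^ (m - a)) (form_t ^ m)"
      by (simp add: \<tau>_def Fract_power eq_fract form_s_nonzero form_t_nonzero ac_simps)
    moreover have "Fract (form_s ^ (m - a)) (form_t ^ m :: 'a poly poly) \<in> twist (- int a) (principal_open form_t)"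
      using homogeneous_power[OF homogeneous_form_s] homogeneous_power[OF homogeneous_form_t]
      by (rule twist_Fract) (use pow \<open>a \<le> m\<close> in auto)
    ultimately show ?thesis by simp
  qed
  moreover have "\<tau> 0 \<noteq> 0" by (simp add: \<tau>_def Zero_fract_def eq_fract form_s_nonzero)
  ultimately show "has_twisted_section m ?F"
    unfolding has_twisted_section_def
    using twist_0[OF principal_open_subset] \<tau>_eq_0
    by (intro bexI[of _ \<tau>] conjI notI) (simp_all add: sum_twists_def)
qed

lemma has_splitting_type_unique:
  fixes \<phi> :: "nat \<Rightarrow> 'a::alg_closed_field poly poly"
  assumes "has_splitting_type d \<phi> a b" "has_splitting_type d \<phi> a' b'"
  shows "a = a'"
proof -
  have iff: "has_twisted_section m (pullback_cotangent_twist \<phi>) \<longleftrightarrow> nat a \<le> m"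
    if "has_splitting_type d \<phi> a b" for m a b
  proof -
    have iso: "sheaf_iso (pullback_cotangent_twist \<phi>) (sum_twists (- int (nat a)) (- int (nat b)))"
      and le: "nat a \<le> nat b" using that by (auto simp: has_splitting_type_def)
    have "has_twisted_section m (pullback_cotangent_twist \<phi>) \<longleftrightarrow>
        has_twisted_section m (sum_twists (- int (nat a)) (- int (nat b)) :: ('a, nat) sheaf)"
      by (rule has_twisted_section_iso_iff[OF iso])
        (rule pullback_cotangent_twist_0 pullback_cotangent_twist_mono pullback_cotangent_twist_scale; assumption)+
    also have "\<dots> \<longleftrightarrow> nat a \<le> m" by (rule has_twisted_section_sum_twists[OF le])
    finally show ?thesis .
  qed
  have "nat a \<le> m \<longleftrightarrow> nat a' \<le> m" for m using iff[OF assms(1)] iff[OF assms(2)] by blast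
  from this[of "nat a"] this[of "nat a'"] have "nat a = nat a'" by simp
  moreover have "0 \<le> a" "0 \<le> a'" using assms by (simp_all add: has_splitting_type_def)
  ultimately show ?thesis by linarith
qed

section \<open>Rank and kernel of a matrix\<close>

lemma linear_map_mult_mat_vec:
  fixes A :: "'a::field mat"
  assumes "A \<in> carrier_mat nr nc"
  shows "linear_map class_ring (module_vec TYPE('a) nc) (module_vec TYPE('a) nr) ((*\<^sub>v) A)"
proof -
  interpret V: vectorspace class_ring "module_vec TYPE('a) nc" by (rule vec_vs)
  interpret W: vectorspace class_ring "module_vec TYPE('a) nr" by (rule vec_vs)
  show ?thesis
    using assms
    by unfold_locales
      (auto simp: module_hom_def module_vec_simps class_ring_simps mult_add_distrib_mat_vec mult_mat_vec)
qed

lemma rank_eq_dim_image: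
  fixes A :: "'a::field mat"
  assumes A: "A \<in> carrier_mat nr nc"
  shows "vec_space.rank nr A =
    vectorspace.dim class_ring (module_vec TYPE('a) nr \<lparr>carrier := (*\<^sub>v) A ` carrier_vec nc\<rparr>)"
proof -
  interpret vec_space "TYPE('a)" nr .
  have "span (set (cols A)) = (*\<^sub>v) A ` carrier_vec nc"
    using col_space_eq[OF A] A by (force simp: col_space_def)
  then show ?thesis by (simp add: rank_def)
qed

text \<open>Rank-nullity twice: injectivity gives the image of \<open>N\<close> dimension
  \<open>k\<close>, and that image is the kernel of \<open>A\<close>.\<close>

lemma rank_nullity_parametrized_kernel:
  fixes A N :: "'a::field mat"
  assumes A: "A \<in> carrier_mat nr nc" and N: "N \<in> carrier_mat nc k"
    and ker: "mat_kernel A = (*\<^sub>v) N ` carrier_vec k"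
    and inj: "inj_on ((*\<^sub>v) N) (carrier_vec k)"
  shows "vec_space.rank nr A + k = nc"
proof -
  interpret S: linear_map class_ring "module_vec TYPE('a) k" "module_vec TYPE('a) nc" "(*\<^sub>v) N"
    by (rule linear_map_mult_mat_vec[OF N])
  interpret T: linear_map class_ring "module_vec TYPE('a) nc" "module_vec TYPE('a) nr" "(*\<^sub>v) A"
    by (rule linear_map_mult_mat_vec[OF A])
  interpret U: vec_space "TYPE('a)" k .
  interpret V: vec_space "TYPE('a)" nc .
  have "S.imT = T.kerT"
    using ker A by (auto simp: S.im_def T.ker_def module_vec_simps mat_kernel)
  moreover have "vectorspace.dim class_ring (module_vec TYPE('a) nc \<lparr>carrier := S.imT\<rparr>)
      + vectorspace.dim class_ring (module_vec TYPE('a) k \<lparr>carrier := S.kerT\<rparr>) = k"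
    using S.rank_nullity[OF U.fin_dim] U.dim_is_n by simp
  moreover have "vectorspace.dim class_ring (module_vec TYPE('a) k \<lparr>carrier := S.kerT\<rparr>) = 0"
    by (rule S.inj_imp_dim_ker0) (use inj in \<open>simp add: module_vec_simps\<close>)
  moreover have "vectorspace.dim class_ring (module_vec TYPE('a) nr \<lparr>carrier := T.imT\<rparr>)
      + vectorspace.dim class_ring (module_vec TYPE('a) nc \<lparr>carrier := T.kerT\<rparr>) = nc"
    using T.rank_nullity[OF V.fin_dim] V.dim_is_n by simp
  moreover have "vec_space.rank nr A = vectorspace.dim class_ring (module_vec TYPE('a) nr \<lparr>carrier := T.imT\<rparr>)"
    by (simp add: rank_eq_dim_image[OF A] T.im_def module_vec_simps)
  ultimately show ?thesis by simp
qed

section \<open>The coefficient matrix\<close>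

lemma sum_lessThan_mult_3:
  fixes g :: "nat \<Rightarrow> 'b::comm_monoid_add"
  shows "(\<Sum>v<3 * n. g v) = (\<Sum>i<3. \<Sum>w<n. g (3 * w + i))"
proof -
  have "(\<Sum>v<3 * n. g v) = (\<Sum>w<n. \<Sum>i<3. g (3 * w + i))"
    by (induction n) (simp_all add: eval_nat_numeral ac_simps)
  then show ?thesis by (simp add: sum.swap[of _ "{..<n}"])
qed

definition trunc_poly :: "nat \<Rightarrow> (nat \<Rightarrow> 'a::comm_monoid_add) \<Rightarrow> 'a poly" where
  "trunc_poly n g = (\<Sum>j<n. monom (g j) j)"

lemma coeff_trunc_poly: "coeff (trunc_poly n g) j = (if j < n then g j else 0)"
  by (simp add: trunc_poly_def coeff_sum sum.delta)

lemma degree_trunc_poly_less: "n > 0 \<Longrightarrow> degree (trunc_poly n g) < n"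
  by (rule degree_lessI) (auto simp: coeff_trunc_poly)

lemma coeff_mult_trunc_poly:
  fixes p :: "'a::comm_semiring_1 poly"
  shows "coeff (trunc_poly n g * p) u = (\<Sum>w<n. if w \<le> u then g w * coeff p (u - w) else 0)"
  unfolding trunc_poly_def sum_distrib_right coeff_sum by (intro sum.cong) (auto simp: coeff_monom_mult)

text \<open>The form with \<open>t = 1\<close>: the coefficient \<open>c j\<close> belongs to \<open>s\<^sup>d\<^sup>-\<^sup>j t\<^sup>j\<close>.\<close>

definition dehomogenized_form :: "nat \<Rightarrow> (nat \<Rightarrow> 'a::comm_monoid_add) \<Rightarrow> 'a poly" where
  "dehomogenized_form d c = trunc_poly (Suc d) (\<lambda>j. c (d - j))"

lemma coeff_dehomogenized_form:
  "coeff (dehomogenized_form d c) j = (if j \<le> d then c (d - j) else 0)"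
  by (simp add: dehomogenized_form_def coeff_trunc_poly less_Suc_eq_le)

lemma degree_dehomogenized_form: "degree (dehomogenized_form d c) \<le> d"
  by (rule degree_le) (simp add: coeff_dehomogenized_form)

lemma binary_form_eq_homogenize: "binary_form d c = homogenize d (dehomogenized_form d c)"
proof -
  have "coeff (coeff (binary_form d c) j) i = (if i + j = d then c j else 0)" for i j
  proof -
    have "coeff (coeff (binary_form d c) j) i = (\<Sum>k\<le>d. if k = j then if d - k = i then c k else 0 else 0)"
      unfolding binary_form_def coeff_sum by (intro sum.cong) auto
    then show ?thesis by (auto simp: sum.delta)
  qed
  then show ?thesis by (auto simp: poly_eq_iff coeff_homogenize coeff_dehomogenized_form)
qed

text \<open>Reads a vector of length \<open>3 * n\<close> as three polynomials of degree below
  \<open>n\<close>, following the numbering \<open>v = 3 w + i\<close> of the matrix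
  columns.\<close>

definition vec_triple :: "nat \<Rightarrow> 'a::comm_monoid_add vec \<Rightarrow> nat \<Rightarrow> 'a poly" where
  "vec_triple n v i = trunc_poly n (\<lambda>w. vec_index v (3 * w + i))"

lemma coeff_matrix_carrier: "coeff_matrix n \<delta> c \<in> carrier_mat (3 * n + \<delta>) (3 * n)"
  by (simp add: coeff_matrix_def)

text \<open>The entry in row \<open>u\<close> and column \<open>3 w + i\<close> is the coefficient
  of \<open>s^(u-w)\<close> in the \<open>i\<close>-th form at \<open>t = 1\<close>, so
  multiplication by the matrix is multiplication of polynomials.\<close>

lemma coeff_matrix_mult_vec:
  fixes c :: "nat \<Rightarrow> nat \<Rightarrow> 'a::comm_ring_1"
  assumes v: "v \<in> carrier_vec (3 * n)" and u: "u < 3 * n + \<delta>"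
  shows "vec_index (coeff_matrix n \<delta> c *\<^sub>v v) u =
    coeff (dot3 (vec_triple n v) (\<lambda>i. dehomogenized_form (2 * n + \<delta>) (c i))) u"
proof -
  let ?d = "2 * n + \<delta>"
  have "vec_index (coeff_matrix n \<delta> c *\<^sub>v v) u =
      (\<Sum>k<3 * n. coeff_matrix n \<delta> c $$ (u, k) * vec_index v k)"
    using v u coeff_matrix_carrier[of n \<delta> c] by (simp add: scalar_prod_def atLeast0LessThan)
  also have "\<dots> = (\<Sum>i<3. \<Sum>w<n. coeff_matrix n \<delta> c $$ (u, 3 * w + i) * vec_index v (3 * w + i))"
    by (rule sum_lessThan_mult_3)
  also have "\<dots> = (\<Sum>i<3. \<Sum>w<n. if w \<le> u
      then vec_index v (3 * w + i) * coeff (dehomogenized_form ?d (c i)) (u - w) else 0)"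
    using u by (intro sum.cong refl)
      (auto simp: coeff_matrix_def coeff_dehomogenized_form Let_def mult.commute)
  also have "\<dots> = coeff (dot3 (vec_triple n v) (\<lambda>i. dehomogenized_form ?d (c i))) u"
    by (simp add: dot3_eq_sum coeff_sum vec_triple_def coeff_mult_trunc_poly)
  finally show ?thesis .
qed

text \<open>The factors have degrees at most \<open>n - 1\<close> and
  \<open>2 * n + \<delta>\<close>, so the rows of the matrix record every coefficient of the
  product.\<close>

lemma degree_mult_dehomogenized_form_less:
  assumes "n > 0"
  shows "degree (dot3 (vec_triple n v) (\<lambda>i. dehomogenized_form (2 * n + \<delta>) (c i))) < 3 * n + \<delta>"
proof -
  have "degree (vec_triple n v i * dehomogenized_form (2 * n + \<delta>) (c i)) < 3 * n + \<delta>" for i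
    using degree_mult_le[of "vec_triple n v i" "dehomogenized_form (2 * n + \<delta>) (c i)"]
      degree_trunc_poly_less[OF assms, of "\<lambda>w. vec_index v (3 * w + i)"]
      degree_dehomogenized_form[of "2 * n + \<delta>" "c i"]
    unfolding vec_triple_def by linarith
  then show ?thesis unfolding dot3_def by (intro degree_add_less) auto
qed

lemma coeff_matrix_kernel:
  fixes c :: "nat \<Rightarrow> nat \<Rightarrow> 'a::field"
  assumes v: "v \<in> carrier_vec (3 * n)"
  shows "v \<in> mat_kernel (coeff_matrix n \<delta> c) \<longleftrightarrow>
    dot3 (vec_triple n v) (\<lambda>i. dehomogenized_form (2 * n + \<delta>) (c i)) = 0"
proof (cases "n = 0")
  case True
  \<comment> \<open>Without columns both sides hold. The degree bound does not cover this case: the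
    zero polynomial has degree 0, which is not below \<open>3 * n + \<delta>\<close> when
    \<open>\<delta> = 0\<close>.\<close>
  have "coeff_matrix n \<delta> c *\<^sub>v v = 0\<^sub>v (3 * n + \<delta>)"
    using v True coeff_matrix_carrier[of n \<delta> c] by (intro eq_vecI) (simp_all add: scalar_prod_def)
  then have "v \<in> mat_kernel (coeff_matrix n \<delta> c)"
    using v coeff_matrix_carrier[of n \<delta> c] by (intro mat_kernelI)
  moreover have "dot3 (vec_triple n v) (\<lambda>i. dehomogenized_form (2 * n + \<delta>) (c i)) = 0"
    using True by (simp add: dot3_def vec_triple_def trunc_poly_def)
  ultimately show ?thesis by simp
next
  case False
  let ?D = "dot3 (vec_triple n v) (\<lambda>i. dehomogenized_form (2 * n + \<delta>) (c i))"
  have "v \<in> mat_kernel (coeff_matrix n \<delta> c) \<longleftrightarrow>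
      (\<forall>u<3 * n + \<delta>. vec_index (coeff_matrix n \<delta> c *\<^sub>v v) u = 0)"
    using v coeff_matrix_carrier[of n \<delta> c] by (auto simp: mat_kernel_def vec_eq_iff)
  also have "\<dots> \<longleftrightarrow> (\<forall>u<3 * n + \<delta>. coeff ?D u = 0)"
    using coeff_matrix_mult_vec[OF v] by simp
  also have "\<dots> \<longleftrightarrow> ?D = 0"
  proof -
    have "coeff ?D u = 0" if "\<not> u < 3 * n + \<delta>" for u
      using degree_mult_dehomogenized_form_less[of n v \<delta> c] False that by (intro coeff_eq_0) simp
    then show ?thesis by (auto simp: poly_eq_iff)
  qed
  finally show ?thesis .
qed

text \<open>The kernel consists of the triples \<open>u P\<close> with \<open>u\<close> of degree
  below \<open>n - a\<close>, hence has dimension \<open>n - a\<close>. The truncated subtraction is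
  right: for \<open>a \<ge> n\<close> the kernel is zero.\<close>

lemma rank_coeff_matrix:
  fixes c :: "nat \<Rightarrow> nat \<Rightarrow> 'a::field" and P :: "nat \<Rightarrow> 'a poly" and n \<delta> :: nat
  defines "f \<equiv> \<lambda>i. dehomogenized_form (2 * n + \<delta>) (c i)"
  assumes P: "\<forall>i<3. degree (P i) \<le> a" "\<exists>i<3. coeff (P i) a \<noteq> 0" "dot3 P f = 0"
    and mult: "\<And>A. n > 0 \<Longrightarrow> dot3 A f = 0 \<Longrightarrow> \<forall>i<3. degree (A i) < n \<Longrightarrow> \<exists>u. \<forall>i<3. A i = u * P i"
  shows "vec_space.rank (3 * n + \<delta>) (coeff_matrix n \<delta> c) + (n - a) = 3 * n"
proof -
  \<comment> \<open>The matrix of \<open>u \<mapsto> u P\<close>: column \<open>j\<close> holds the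
    coefficients of \<open>s^j P\<close> in the numbering of \<open>vec_triple\<close>.\<close>
  define N where "N = mat (3 * n) (n - a)
    (\<lambda>(r, j). if j \<le> r div 3 then coeff (P (r mod 3)) (r div 3 - j) else 0)"
  define U where "U y = trunc_poly (n - a) (vec_index y)" for y :: "'a vec"
  have N: "N \<in> carrier_mat (3 * n) (n - a)" by (simp add: N_def)
  have deg_UP: "coeff (U y * P i) w = 0" if "w \<ge> n" "i < 3" for y w i
  proof (cases "n - a = 0")
    case True
    then show ?thesis by (simp add: U_def trunc_poly_def)
  next
    case False
    then have "degree (U y) < n - a" unfolding U_def by (intro degree_trunc_poly_less) simp
    moreover have "degree (P i) \<le> a" using P(1) that(2) by blast
    ultimately have "degree (U y * P i) < n" using degree_mult_le[of "U y" "P i"] by linarith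
    then show ?thesis using that(1) by (intro coeff_eq_0) simp
  qed
  have NU: "vec_triple n (N *\<^sub>v y) i = U y * P i" if y: "y \<in> carrier_vec (n - a)" and i: "i < 3" for y i
  proof (rule poly_eqI)
    fix w
    show "coeff (vec_triple n (N *\<^sub>v y) i) w = coeff (U y * P i) w"
    proof (cases "w < n")
      case True
      then have r: "3 * w + i < 3 * n" using i by linarith
      have "vec_index (N *\<^sub>v y) (3 * w + i) = (\<Sum>j<n - a. N $$ (3 * w + i, j) * vec_index y j)"
        using N y r by (simp add: scalar_prod_def atLeast0LessThan)
      also have "\<dots> = (\<Sum>j<n - a. if j \<le> w then vec_index y j * coeff (P i) (w - j) else 0)"
        using r i by (intro sum.cong refl) (auto simp: N_def mult.commute)
      also have "\<dots> = coeff (U y * P i) w" by (simp add: U_def coeff_mult_trunc_poly)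
      finally show ?thesis using True by (simp add: vec_triple_def coeff_trunc_poly)
    next
      case False
      then show ?thesis using deg_UP[of w i y] i by (simp add: vec_triple_def coeff_trunc_poly)
    qed
  qed
  have vec_triple_inj: "v = v'"
    if "v \<in> carrier_vec (3 * n)" "v' \<in> carrier_vec (3 * n)" "\<forall>i<3. vec_triple n v i = vec_triple n v' i" for v v'
  proof (rule eq_vecI)
    fix r assume "r < dim_vec v'"
    then have r: "r div 3 < n" "r mod 3 < 3" using that(2) by (auto simp: less_mult_imp_div_less mult.commute)
    have "coeff (vec_triple n v (r mod 3)) (r div 3) = coeff (vec_triple n v' (r mod 3)) (r div 3)"
      using that(3) r(2) by simp
    then show "vec_index v r = vec_index v' r"
      using r(1) by (simp add: vec_triple_def coeff_trunc_poly)
  qed (use that in auto)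
  have Ny: "N *\<^sub>v y \<in> carrier_vec (3 * n)" if "y \<in> carrier_vec (n - a)" for y
    using N that by simp
  obtain k where k: "k < 3" "coeff (P k) a \<noteq> 0" using P(2) by blast
  show ?thesis
  proof (rule rank_nullity_parametrized_kernel[OF coeff_matrix_carrier N])
    show "inj_on ((*\<^sub>v) N) (carrier_vec (n - a))"
    proof (rule inj_onI)
      fix y y' assume y: "y \<in> carrier_vec (n - a)" "y' \<in> carrier_vec (n - a)" "N *\<^sub>v y = N *\<^sub>v y'"
      then have "U y * P k = U y' * P k" using NU k(1) by metis
      then have "U y = U y'" using k(2) by auto
      then have eq: "coeff (U y) j = coeff (U y') j" for j by simp
      show "y = y'"
      proof (rule eq_vecI)
        fix j assume "j < dim_vec y'"
        then show "vec_index y j = vec_index y' j" using eq[of j] y(2) by (simp add: U_def coeff_trunc_poly)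
      qed (use y in auto)
    qed
    show "mat_kernel (coeff_matrix n \<delta> c) = (*\<^sub>v) N ` carrier_vec (n - a)"
    proof (intro equalityI subsetI)
      fix v assume "v \<in> (*\<^sub>v) N ` carrier_vec (n - a)"
      then obtain y where y: "y \<in> carrier_vec (n - a)" "v = N *\<^sub>v y" by blast
      have "dot3 (vec_triple n v) f = dot3 (\<lambda>i. U y * P i) f"
        by (rule dot3_cong) (simp_all add: y NU)
      also have "\<dots> = U y * dot3 P f" by (simp add: dot3_def algebra_simps)
      finally show "v \<in> mat_kernel (coeff_matrix n \<delta> c)"
        using coeff_matrix_kernel[OF Ny[OF y(1)], of \<delta> c] P(3) by (simp add: y(2) f_def)
    next
      fix v assume v: "v \<in> mat_kernel (coeff_matrix n \<delta> c)"
      then have v_car: "v \<in> carrier_vec (3 * n)" by (rule mat_kernelD(1)[OF coeff_matrix_carrier])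
      have "\<exists>u. \<forall>i<3. vec_triple n v i = u * P i \<and> (\<forall>j\<ge>n - a. coeff u j = 0)"
      proof (cases "n = 0")
        case True
        then show ?thesis by (intro exI[of _ 0]) (simp add: vec_triple_def trunc_poly_def)
      next
        case False
        have deg: "degree (vec_triple n v i) < n" for i
          using False by (simp add: vec_triple_def degree_trunc_poly_less)
        have "dot3 (vec_triple n v) f = 0" using v coeff_matrix_kernel[OF v_car] by (simp add: f_def)
        then obtain u where u: "\<forall>i<3. vec_triple n v i = u * P i" using mult False deg by blast
        \<comment> \<open>\<open>P k\<close> has degree at least \<open>a\<close> and
          \<open>u * P k\<close> has degree below \<open>n\<close>, so a nonzero \<open>u\<close>
          has degree below \<open>n - a\<close>.\<close>
        have "coeff u j = 0" if "j \<ge> n - a" for j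
        proof (cases "u = 0")
          case False
          have "P k \<noteq> 0" using k(2) by auto
          have "a \<le> degree (P k)" using k(2) by (rule le_degree)
          have "degree u + degree (P k) < n"
            using deg[of k] u k(1) False \<open>P k \<noteq> 0\<close> by (simp add: degree_mult_eq)
          then show ?thesis using that \<open>a \<le> degree (P k)\<close> by (intro coeff_eq_0) linarith
        qed simp
        then show ?thesis using u by blast
      qed
      then obtain u where u: "\<forall>i<3. vec_triple n v i = u * P i" "\<forall>j\<ge>n - a. coeff u j = 0"
        by (metis zero_less_numeral)
      define y where "y = vec (n - a) (coeff u)"
      have y: "y \<in> carrier_vec (n - a)" by (simp add: y_def)
      have "U y = u"
        using u(2) by (auto simp: U_def y_def poly_eq_iff coeff_trunc_poly)
      then have "\<forall>i<3. vec_triple n v i = vec_triple n (N *\<^sub>v y) i" using u(1) NU[OF y] by simp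
      then have "v = N *\<^sub>v y" by (rule vec_triple_inj[OF v_car Ny[OF y]])
      then show "v \<in> (*\<^sub>v) N ` carrier_vec (n - a)" using y by blast
    qed
  qed
qed

section \<open>From forms without common factor to polynomials without common zero\<close>

lemma not_is_unit_if_eval2_eq_0: "eval2 g v = 0 \<Longrightarrow> \<not> is_unit g"
  using eval2_mult[of g _ v] by (auto simp: dvd_def) (metis eval2_1 mult_zero_left zero_neq_one)

lemma linear_form_dvd_homogenize:
  fixes w :: "'a::field poly"
  assumes "degree w \<le> 1" "p = w * p'" "degree p' \<le> d - 1" "d = 0 \<Longrightarrow> p = 0"
  shows "homogenize 1 w dvd homogenize d p"
proof (cases "d = 0")
  case False
  then have "homogenize d p = homogenize 1 w * homogenize (d - 1) p'"
    using homogenize_mult[OF assms(1,3)] by (simp add: assms(2))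
  then show ?thesis by simp
qed (use assms in simp)

text \<open>A common root \<open>r\<close> makes the form \<open>s - r t\<close> a common factor,
  and common vanishing of the coefficients at \<open>d\<close> makes \<open>t\<close> one. Neither
  is a unit, as each has a zero.\<close>

lemma no_common_zero:
  fixes f :: "nat \<Rightarrow> 'a::field poly"
  assumes unit: "\<forall>g. (\<forall>i<m. g dvd homogenize d (f i)) \<longrightarrow> is_unit g"
    and deg: "\<forall>i<m. degree (f i) \<le> d"
  shows "\<exists>i<m. poly (f i) r \<noteq> 0" "\<exists>i<m. coeff (f i) d \<noteq> 0"
proof -
  show "\<exists>i<m. poly (f i) r \<noteq> 0"
  proof (rule ccontr)
    assume *: "\<not> ?thesis"
    have "homogenize 1 [:-r, 1:] dvd homogenize d (f i)" if i: "i < m" for i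
    proof -
      have "[:-r, 1:] dvd f i" using * i by (simp add: poly_eq_0_iff_dvd)
      then obtain p where p: "f i = [:-r, 1:] * p" by (rule dvdE)
      show ?thesis
      proof (rule linear_form_dvd_homogenize[OF _ p])
        show "degree p \<le> d - 1"
          using deg i unfolding p[symmetric] by (intro degree_le_pred_if_linear_mult[of r]) (simp only: p[symmetric])
        \<comment> \<open>In degree 0 no linear factor can be split off, but a constant with a root
          is 0, which everything divides.\<close>
        show "f i = 0" if "d = 0"
        proof -
          have "degree (f i) = 0" using deg i that by simp
          then obtain e where "f i = [:e:]" by (rule degree_eq_zeroE)
          then show ?thesis using * i by auto
        qed
      qed simp
    qed
    then have "is_unit (homogenize 1 [:-r, 1:])" using unit by blast
    moreover have "eval2 (homogenize 1 [:-r, 1:]) (affine_vec r) = 0"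
      by (subst eval2_homogenize_affine) simp_all
    ultimately show False using not_is_unit_if_eval2_eq_0 by blast
  qed
  show "\<exists>i<m. coeff (f i) d \<noteq> 0"
  proof (rule ccontr)
    assume *: "\<not> ?thesis"
    have "homogenize 1 1 dvd homogenize d (f i)" if i: "i < m" for i
    proof (rule linear_form_dvd_homogenize[of _ _ "f i"])
      have "coeff (f i) d = 0" using * i by blast
      then show "degree (f i) \<le> d - 1"
        using deg i degree_le_pred_if_coeff_0[of "f i" d] by (cases "d = 0") auto
      show "f i = 0" if "d = 0"
      proof -
        have "degree (f i) = 0" using deg i that by simp
        then obtain e where "f i = [:e:]" by (rule degree_eq_zeroE)
        then show ?thesis using \<open>coeff (f i) d = 0\<close> that by simp
      qed
    qed simp_all
    then have "is_unit (homogenize 1 (1 :: 'a poly))" using unit by blast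
    moreover have "eval2 (homogenize 1 (1 :: 'a poly)) infinity_vec = 0"
      by (simp add: eval2_homogenize_infinity)
    ultimately show False using not_is_unit_if_eval2_eq_0 by blast
  qed
qed

lemma P1_cases:
  fixes P :: "'a::field vec set"
  assumes "P \<in> P1"
  obtains r where "affine_vec r \<in> P" "P = proj_point (affine_vec r)" | "P = proj_point infinity_vec"
proof -
  obtain v where v: "v \<in> carrier_vec 2" "v \<noteq> 0\<^sub>v 2" "P = proj_point v" using assms by (rule P1_E)
  have scaled: "proj_point (e \<cdot>\<^sub>v w) = proj_point w" if "e \<noteq> 0" for e :: 'a and w
  proof -
    have "\<exists>b. a \<cdot>\<^sub>v w = b \<cdot>\<^sub>v (e \<cdot>\<^sub>v w) \<and> b \<noteq> 0" if "a \<noteq> 0" for a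
      using that \<open>e \<noteq> 0\<close> by (intro exI[of _ "a / e"]) (simp add: smult_smult_assoc)
    moreover have "\<exists>b. a \<cdot>\<^sub>v (e \<cdot>\<^sub>v w) = b \<cdot>\<^sub>v w \<and> b \<noteq> 0" if "a \<noteq> 0" for a
      using that \<open>e \<noteq> 0\<close> by (intro exI[of _ "a * e"]) (simp add: smult_smult_assoc)
    ultimately show ?thesis unfolding proj_point_def by blast
  qed
  show ?thesis
  proof (cases "vec_index v 1 = 0")
    case True
    then have "vec_index v 0 \<noteq> 0" using v by (auto simp: vec_eq_iff numeral_2_eq_2 less_Suc_eq)
    moreover have "v = vec_index v 0 \<cdot>\<^sub>v infinity_vec"
      using v True by (auto simp: vec_eq_iff less_2_cases_iff)
    ultimately have "P = proj_point infinity_vec" using scaled v(3) by metis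
    then show ?thesis by (rule that(2))
  next
    case False
    have "v = vec_index v 1 \<cdot>\<^sub>v affine_vec (vec_index v 0 / vec_index v 1)"
      using v False by (auto simp: vec_eq_iff less_2_cases_iff)
    then have "P = proj_point (affine_vec (vec_index v 0 / vec_index v 1))"
      using scaled[OF False] v(3) by metis
    then show ?thesis using proj_point_self that(1) by blast
  qed
qed

section \<open>Splitting type and rank from one basis of the syzygies\<close>

theorem theorem2p4p2:
  fixes \<phi> :: "nat \<Rightarrow> 'a::alg_closed_field poly poly"
    and c :: "nat \<Rightarrow> nat \<Rightarrow> 'a"
    and C :: "'a vec set set"
    and n \<delta> d :: nat
    and p :: int
  assumes "\<delta> \<in> {0, 1}"
    and "d = 2 * n + \<delta>"
    and "parameterizes_rational_curve d \<phi> C"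
    and "\<forall>i<3. \<phi> i = binary_form d (c i)"
  shows "has_splitting_type d \<phi> (int n - p) (int n + p + int \<delta>) \<longleftrightarrow>
         int (vec_space.rank (3 * n + \<delta>) (coeff_matrix n \<delta> c)) = 3 * int n - p"
proof -
  define f where "f i = dehomogenized_form d (c i)" for i
  have \<phi>: "\<phi> i = homogenize d (f i)" if "i < 3" for i
    using assms(4) that by (simp add: f_def binary_form_eq_homogenize)
  have unit: "\<forall>g. (\<forall>i<3. g dvd homogenize d (f i)) \<longrightarrow> is_unit g"
    using assms(3) \<phi> by (simp add: parameterizes_rational_curve_def)
  have deg: "\<forall>i<3. degree (f i) \<le> d" by (simp add: f_def degree_dehomogenized_form)
  note nz = no_common_zero[OF unit deg]
  have root: "\<forall>r. \<exists>i<3. poly (f i) r \<noteq> 0" using nz(1) by blast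
  obtain P Q a b where ab: "a + b = d" "a \<le> b"
    and P: "\<forall>i<3. degree (P i) \<le> a" and Q: "\<forall>i<3. degree (Q i) \<le> b"
    and P_top: "\<exists>i<3. coeff (P i) a \<noteq> 0"
    and PQ: "\<forall>i<3. cross3 P Q i = f i"
    and mult: "\<forall>A. dot3 A f = 0 \<longrightarrow> (\<forall>i<3. degree (A i) < b) \<longrightarrow> (\<exists>u. \<forall>i<3. A i = u * P i)"
    by (rule mu_basis[OF deg nz(2) root]) (rule that)
  \<comment> \<open>This uses \<open>\<delta> \<le> 1\<close>. By \<open>n \<le> b\<close>, all
    syzygies of degree below \<open>n\<close> are multiples of \<open>P\<close>; by
    \<open>a \<le> n\<close>, the subtraction \<open>n - a\<close> is exact.\<close>
  have "a \<le> n" "n \<le> b" using ab assms(1,2) by auto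
  have "sheaf_iso (pullback_cotangent_twist \<phi>) (sum_twists (- int a) (- int b))"
  proof (rule pullback_cotangent_twist_iso[of a b])
    fix i :: nat assume i: "i < 3"
    show "homogeneous (a + b) (\<phi> i)" using i by (simp add: \<phi> ab homogeneous_homogenize)
    have mod: "(i + 1) mod 3 < 3" "(i + 2) mod 3 < 3" by simp_all
    have f: "f i = P ((i + 1) mod 3) * Q ((i + 2) mod 3) - P ((i + 2) mod 3) * Q ((i + 1) mod 3)"
      using PQ i unfolding cross3_def by simp
    show "cross3 (\<lambda>i. homogenize a (P i)) (\<lambda>i. homogenize b (Q i)) i = \<phi> i"
      using P Q mod
      unfolding \<phi>[OF i] f homogenize_diff ab(1)[symmetric] cross3_def
      by (simp add: homogenize_mult)
  next
    fix X :: "'a vec set" assume "X \<in> P1"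
    then show "\<exists>i<3. X \<in> principal_open (\<phi> i)"
    proof (cases rule: P1_cases)
      case (1 r)
      obtain i where i: "i < 3" "poly (f i) r \<noteq> 0" using nz(1) by blast
      then have "X \<in> principal_open (\<phi> i)"
        unfolding 1(2) \<phi>[OF i(1)] using deg
        by (intro proj_point_in_principal_open[OF homogeneous_homogenize _ affine_vec_in_P1])
          (simp_all add: eval2_homogenize_affine)
      then show ?thesis using i(1) by blast
    next
      case 2
      obtain i where i: "i < 3" "coeff (f i) d \<noteq> 0" using nz(2) by blast
      then have "X \<in> principal_open (\<phi> i)"
        unfolding 2 \<phi>[OF i(1)]
        by (intro proj_point_in_principal_open[OF homogeneous_homogenize _ infinity_vec_in_P1])
          (simp_all add: eval2_homogenize_infinity)
      then show ?thesis using i(1) by blast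
    qed
  qed (simp_all add: homogeneous_homogenize)
  then have type: "has_splitting_type d \<phi> (int a) (int b)"
    using ab by (simp add: has_splitting_type_def)
  have "dot3 P f = dot3 P (cross3 P Q)" by (rule dot3_cong) (simp_all add: PQ)
  then have "dot3 P f = 0" by (simp add: dot3_cross3)
  have f_eq: "(\<lambda>i. dehomogenized_form (2 * n + \<delta>) (c i)) = f"
    by (simp add: f_def assms(2) fun_eq_iff)
  have "vec_space.rank (3 * n + \<delta>) (coeff_matrix n \<delta> c) + (n - a) = 3 * n"
  proof (rule rank_coeff_matrix[OF P P_top])
    show "dot3 P (\<lambda>i. dehomogenized_form (2 * n + \<delta>) (c i)) = 0"
      using \<open>dot3 P f = 0\<close> by (simp only: f_eq)
    show "\<exists>u. \<forall>i<3. A i = u * P i"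
      if "dot3 A (\<lambda>i. dehomogenized_form (2 * n + \<delta>) (c i)) = 0" "\<forall>i<3. degree (A i) < n" for A
    proof (rule mult[rule_format])
      show "dot3 A f = 0" using that(1) by (simp only: f_eq)
      show "degree (A i) < b" if "i < 3" for i using \<open>\<forall>i<3. degree (A i) < n\<close> \<open>n \<le> b\<close> that by fastforce
    qed
  qed
  then have rank: "int (vec_space.rank (3 * n + \<delta>) (coeff_matrix n \<delta> c)) = 3 * int n - (int n - int a)"
    using \<open>a \<le> n\<close> by linarith
  have b: "int b = int n + (int n - int a) + int \<delta>" using ab(1) assms(2) by linarith
  \<comment> \<open>Both sides now say \<open>p = n - a\<close>: the left one by uniqueness of the
    splitting type, the right one by the rank formula.\<close>
  show ?thesis
  proof
    assume "has_splitting_type d \<phi> (int n - p) (int n + p + int \<delta>)"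
    then have "int n - p = int a" using type by (rule has_splitting_type_unique)
    then show "int (vec_space.rank (3 * n + \<delta>) (coeff_matrix n \<delta> c)) = 3 * int n - p"
      using rank by linarith
  next
    assume "int (vec_space.rank (3 * n + \<delta>) (coeff_matrix n \<delta> c)) = 3 * int n - p"
    then have p: "int n - p = int a" "int n + p + int \<delta> = int b" using rank b by linarith+
    show "has_splitting_type d \<phi> (int n - p) (int n + p + int \<delta>)" unfolding p by (rule type)
  qed
qed

end
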